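(* Let $G$ be a finite group, $\mathcal{H}$ a finite multiset of subgroups of $G$, and $\mathcal{D}$ an admissible set of subgroups of $G$. Then $\operatorname{Sha}_{\mathcal{D}}^{2}(G,J_{G/\mathcal{H}})=\operatorname{Sha}_{\mathcal{D}_{(\mathcal{H})}}^{2}(G,J_{G/\mathcal{H}})$, where $\mathcal{D}_{(\mathcal{H})}:=\mathcal{D}\setminus\{D\in\mathcal{C}_{G}\mid D\not\subset H\text{ for every }H\in\mathcal{H}\}$ and $\mathcal{C}_G$ is the set of cyclic subgroups of $G$.
   Context: For a finite multiset $\mathcal{H}$ of subgroups of $G$, $J_{G/\mathcal{H}}$ is the cokernel of the $G$-map $\mathbb{Z}\to\bigoplus_{H\in\mathcal{H}}\operatorname{Ind}_H^G\mathbb{Z}$ (sum with multiplicity) sending $1$ to the constant function $1$ in each summand, where $\operatorname{Ind}_H^G\mathbb{Z}=\mathrm{Hom}_{\mathbb{Z}[H]}(\mathbb{Z}[G],\mathbb{Z})$ with $(g\varphi)(g')=\varphi(g'g)$. For a set $\mathcal{D}$ of subgroups and a $G$-module $M$, $\operatorname{Sha}^2_{\mathcal{D}}(G,M):=\ker\big(H^2(G,M)\to\bigoplus_{D\in\mathcal{D}}H^2(D,M)\big)$. A finite set of subgroups of $G$ is admissible if it contains all cyclic subgroups and is stable under conjugation. *)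

theory Defs
  imports "HOL-Algebra.Product_Groups" "HOL-Library.Multiset"
begin

text \<open>
  Modules over a group are abelian groups in the multiplicative notation of HOL-Algebra,
  together with an action of the group. As \<open>G\<close> acts only through the field \<open>gact\<close>,
  restricting a \<open>G\<close>-module to a subgroup leaves the record unchanged.
\<close>

record ('g, 'm) gmodule = "'m monoid" +
  gact :: "'g \<Rightarrow> 'm \<Rightarrow> 'm"

locale G_module = group G + M: comm_group M
  for G (structure) and M :: "('g, 'm, 'z) gmodule_scheme" +
  assumes gact_hom: "g \<in> carrier G \<Longrightarrow> gact M g \<in> hom M M"
    and gact_one: "m \<in> carrier M \<Longrightarrow> gact M \<one> m = m"
    and gact_mult: "\<lbrakk>g \<in> carrier G; h \<in> carrier G; m \<in> carrier M\<rbrakk>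
          \<Longrightarrow> gact M (g \<otimes> h) m = gact M g (gact M h m)"


subsection \<open>Cohomology in degree 2\<close>

text \<open>Inhomogeneous cochains in degrees 1, 2, 3, and the coboundary maps between them.\<close>

definition C1 :: "('g, 'x) monoid_scheme \<Rightarrow> ('g, 'm, 'z) gmodule_scheme \<Rightarrow> ('g \<Rightarrow> 'm) monoid"
  where "C1 G M = product_group (carrier G) (\<lambda>_. M)"

definition C2 :: "('g, 'x) monoid_scheme \<Rightarrow> ('g, 'm, 'z) gmodule_scheme \<Rightarrow> ('g \<times> 'g \<Rightarrow> 'm) monoid"
  where "C2 G M = product_group (carrier G \<times> carrier G) (\<lambda>_. M)"

definition C3 :: "('g, 'x) monoid_scheme \<Rightarrow> ('g, 'm, 'z) gmodule_scheme
    \<Rightarrow> ('g \<times> 'g \<times> 'g \<Rightarrow> 'm) monoid"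
  where "C3 G M = product_group (carrier G \<times> carrier G \<times> carrier G) (\<lambda>_. M)"

definition d1 :: "('g, 'x) monoid_scheme \<Rightarrow> ('g, 'm, 'z) gmodule_scheme
    \<Rightarrow> ('g \<Rightarrow> 'm) \<Rightarrow> ('g \<times> 'g \<Rightarrow> 'm)"
  where "d1 G M c = (\<lambda>(g, h) \<in> carrier G \<times> carrier G.
           gact M g (c h) \<otimes>\<^bsub>M\<^esub> inv\<^bsub>M\<^esub> c (g \<otimes>\<^bsub>G\<^esub> h) \<otimes>\<^bsub>M\<^esub> c g)"

definition d2 :: "('g, 'x) monoid_scheme \<Rightarrow> ('g, 'm, 'z) gmodule_scheme
    \<Rightarrow> ('g \<times> 'g \<Rightarrow> 'm) \<Rightarrow> ('g \<times> 'g \<times> 'g \<Rightarrow> 'm)"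
  where "d2 G M f = (\<lambda>(g, h, k) \<in> carrier G \<times> carrier G \<times> carrier G.
           gact M g (f (h, k)) \<otimes>\<^bsub>M\<^esub> inv\<^bsub>M\<^esub> f (g \<otimes>\<^bsub>G\<^esub> h, k)
             \<otimes>\<^bsub>M\<^esub> f (g, h \<otimes>\<^bsub>G\<^esub> k) \<otimes>\<^bsub>M\<^esub> inv\<^bsub>M\<^esub> f (g, h))"

definition Z2 :: "('g, 'x) monoid_scheme \<Rightarrow> ('g, 'm, 'z) gmodule_scheme \<Rightarrow> ('g \<times> 'g \<Rightarrow> 'm) set"
  where "Z2 G M = kernel (C2 G M) (C3 G M) (d2 G M)"

definition B2 :: "('g, 'x) monoid_scheme \<Rightarrow> ('g, 'm, 'z) gmodule_scheme \<Rightarrow> ('g \<times> 'g \<Rightarrow> 'm) set"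
  where "B2 G M = d1 G M ` carrier (C1 G M)"

definition H2 :: "('g, 'x) monoid_scheme \<Rightarrow> ('g, 'm, 'z) gmodule_scheme
    \<Rightarrow> ('g \<times> 'g \<Rightarrow> 'm) set monoid"
  where "H2 G M = (C2 G M)\<lparr>carrier := Z2 G M\<rparr> Mod B2 G M"

text \<open>
  A class is a coset of \<open>B2 G M\<close>. All its members restrict to the same class over \<open>D\<close>,
  so the union below is that one coset of \<open>B2\<close> over \<open>D\<close> (see \<open>res2_coset\<close>).
\<close>

definition res2 :: "('g, 'x) monoid_scheme \<Rightarrow> ('g, 'm, 'z) gmodule_scheme \<Rightarrow> 'g set
    \<Rightarrow> ('g \<times> 'g \<Rightarrow> 'm) set \<Rightarrow> ('g \<times> 'g \<Rightarrow> 'm) set"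
  where "res2 G M D X =
           (\<Union>f \<in> X. B2 (G\<lparr>carrier := D\<rparr>) M #>\<^bsub>C2 (G\<lparr>carrier := D\<rparr>) M\<^esub> restrict f (D \<times> D))"

definition Sha2 :: "('g, 'x) monoid_scheme \<Rightarrow> 'g set set \<Rightarrow> ('g, 'm, 'z) gmodule_scheme
    \<Rightarrow> ('g \<times> 'g \<Rightarrow> 'm) set set"
  where "Sha2 G \<D> M =
           kernel (H2 G M) (sum_group \<D> (\<lambda>D. H2 (G\<lparr>carrier := D\<rparr>) M)) (\<lambda>X. \<lambda>D \<in> \<D>. res2 G M D X)"


subsection \<open>The module \<open>J\<close>\<close>

text \<open>
  An element of $\mathrm{Hom}_{\mathbb{Z}[H]}(\mathbb{Z}[G], \mathbb{Z})$ is given by its values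
  on the basis \<open>G\<close> of $\mathbb{Z}[G]$, which form a left \<open>H\<close>-invariant function on \<open>G\<close>.
\<close>

definition Ind :: "('g, 'x) monoid_scheme \<Rightarrow> 'g set \<Rightarrow> ('g, 'g \<Rightarrow> int) gmodule"
  where "Ind G H =
    \<lparr>carrier = {\<phi> \<in> carrier G \<rightarrow>\<^sub>E UNIV. \<forall>h \<in> H. \<forall>g \<in> carrier G. \<phi> (h \<otimes>\<^bsub>G\<^esub> g) = \<phi> g},
     monoid.mult = (\<lambda>\<phi> \<psi>. \<lambda>x \<in> carrier G. \<phi> x + \<psi> x),
     one = (\<lambda>x \<in> carrier G. 0),
     gact = (\<lambda>g \<phi>. \<lambda>x \<in> carrier G. \<phi> (x \<otimes>\<^bsub>G\<^esub> g))\<rparr>"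

definition sum_gmodule :: "'i set \<Rightarrow> ('i \<Rightarrow> ('g, 'm, 'z) gmodule_scheme) \<Rightarrow> ('g, 'i \<Rightarrow> 'm) gmodule"
  where "sum_gmodule I M =
    \<lparr>carrier = carrier (sum_group I M),
     monoid.mult = monoid.mult (sum_group I M),
     one = one (sum_group I M),
     gact = (\<lambda>g f. \<lambda>i \<in> I. gact (M i) g (f i))\<rparr>"

text \<open>
  The elements of the cokernel are the cosets \<open>X\<close> of the image, and \<open>g\<close> sends the coset of \<open>n\<close>
  to the coset of \<open>g n\<close>, which is the image of \<open>X\<close> under \<open>g\<close> when the image is \<open>G\<close>-stable.
\<close>

definition coker_gmodule :: "('a, 'x) monoid_scheme \<Rightarrow> ('g, 'm, 'z) gmodule_scheme \<Rightarrow> ('a \<Rightarrow> 'm)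
    \<Rightarrow> ('g, 'm set) gmodule"
  where "coker_gmodule A N f =
    \<lparr>carrier = carrier (N Mod f ` carrier A),
     monoid.mult = monoid.mult (N Mod f ` carrier A),
     one = one (N Mod f ` carrier A),
     gact = (\<lambda>g X. gact N g ` X)\<rparr>"

text \<open>The summands indexed by the multiset: \<open>H\<close> occurs as \<open>(H, 0), \<dots>, (H, count \<H> H - 1)\<close>.\<close>

definition mset_index :: "'a multiset \<Rightarrow> ('a \<times> nat) set"
  where "mset_index \<H> = (SIGMA H:set_mset \<H>. {..<count \<H> H})"

definition sum_Ind :: "('g, 'x) monoid_scheme \<Rightarrow> 'g set multiset
    \<Rightarrow> ('g, 'g set \<times> nat \<Rightarrow> 'g \<Rightarrow> int) gmodule"
  where "sum_Ind G \<H> = sum_gmodule (mset_index \<H>) (\<lambda>(H, _). Ind G H)"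

definition const_Ind :: "('g, 'x) monoid_scheme \<Rightarrow> 'g set multiset
    \<Rightarrow> int \<Rightarrow> 'g set \<times> nat \<Rightarrow> 'g \<Rightarrow> int"
  where "const_Ind G \<H> n = (\<lambda>p \<in> mset_index \<H>. \<lambda>x \<in> carrier G. n)"

definition J_module :: "('g, 'x) monoid_scheme \<Rightarrow> 'g set multiset
    \<Rightarrow> ('g, ('g set \<times> nat \<Rightarrow> 'g \<Rightarrow> int) set) gmodule"
  where "J_module G \<H> = coker_gmodule integer_group (sum_Ind G \<H>) (const_Ind G \<H>)"


subsection \<open>Families of subgroups\<close>

definition cyclic_subgroups :: "('g, 'x) monoid_scheme \<Rightarrow> 'g set set"
  where "cyclic_subgroups G = {C. \<exists>g \<in> carrier G. C = generate G {g}}"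

definition admissible :: "('g, 'x) monoid_scheme \<Rightarrow> 'g set set \<Rightarrow> bool"
  where "admissible G \<D> \<longleftrightarrow> finite \<D> \<and> (\<forall>D \<in> \<D>. subgroup D G) \<and> cyclic_subgroups G \<subseteq> \<D> \<and>
           (\<forall>D \<in> \<D>. \<forall>g \<in> carrier G. g <#\<^bsub>G\<^esub> D #>\<^bsub>G\<^esub> inv\<^bsub>G\<^esub> g \<in> \<D>)"

definition remove_cyclic :: "('g, 'x) monoid_scheme \<Rightarrow> 'g set multiset \<Rightarrow> 'g set set \<Rightarrow> 'g set set"
  where "remove_cyclic G \<H> \<D> = \<D> - {D \<in> cyclic_subgroups G. \<forall>H \<in># \<H>. \<not> D \<subseteq> H}"


subsection \<open>Well-definedness\<close>

context G_module
begin

lemma gact_closed [simp]: "\<lbrakk>g \<in> carrier G; m \<in> carrier M\<rbrakk> \<Longrightarrow> gact M g m \<in> carrier M"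
  by (rule hom_in_carrier[OF gact_hom])

lemma gact_prod [simp]: "\<lbrakk>g \<in> carrier G; m \<in> carrier M; n \<in> carrier M\<rbrakk>
    \<Longrightarrow> gact M g (m \<otimes>\<^bsub>M\<^esub> n) = gact M g m \<otimes>\<^bsub>M\<^esub> gact M g n"
  by (rule hom_mult[OF gact_hom])

lemma gact_inv [simp]: "\<lbrakk>g \<in> carrier G; m \<in> carrier M\<rbrakk>
    \<Longrightarrow> gact M g (inv\<^bsub>M\<^esub> m) = inv\<^bsub>M\<^esub> gact M g m"
  using group_hom.hom_inv[of M M "gact M g" m] gact_hom
  by (simp add: group_hom_def group_hom_axioms_def M.group_axioms)

lemma G_module_subgroup: "subgroup D G \<Longrightarrow> G_module (G\<lparr>carrier := D\<rparr>) M"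
  using subgroup.mem_carrier[of D G]
  by (auto simp: G_module_def G_module_axioms_def subgroup_imp_group M.comm_group_axioms
      gact_hom gact_one gact_mult)

lemma group_C2: "comm_group (C2 G M)"
proof -
  interpret C: group "C2 G M" by (simp add: C2_def M.group_axioms)
  show ?thesis
    by (rule C.group_comm_groupI) (auto simp: C2_def PiE_iff M.m_comm intro!: restrict_ext)
qed

lemma d2_hom: "group_hom (C2 G M) (C3 G M) (d2 G M)"
proof -
  have swap: "(a \<otimes>\<^bsub>M\<^esub> a') \<otimes>\<^bsub>M\<^esub> inv\<^bsub>M\<^esub> (b \<otimes>\<^bsub>M\<^esub> b') \<otimes>\<^bsub>M\<^esub> (c \<otimes>\<^bsub>M\<^esub> c') \<otimes>\<^bsub>M\<^esub> inv\<^bsub>M\<^esub> (d \<otimes>\<^bsub>M\<^esub> d')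
      = (a \<otimes>\<^bsub>M\<^esub> inv\<^bsub>M\<^esub> b \<otimes>\<^bsub>M\<^esub> c \<otimes>\<^bsub>M\<^esub> inv\<^bsub>M\<^esub> d) \<otimes>\<^bsub>M\<^esub> (a' \<otimes>\<^bsub>M\<^esub> inv\<^bsub>M\<^esub> b' \<otimes>\<^bsub>M\<^esub> c' \<otimes>\<^bsub>M\<^esub> inv\<^bsub>M\<^esub> d')"
    if "a \<in> carrier M" "b \<in> carrier M" "c \<in> carrier M" "d \<in> carrier M"
      "a' \<in> carrier M" "b' \<in> carrier M" "c' \<in> carrier M" "d' \<in> carrier M" for a b c d a' b' c' d'
    using that by (simp add: M.inv_mult M.m_ac)
  have "d2 G M \<in> hom (C2 G M) (C3 G M)"
    by (rule homI) (auto simp: C2_def C3_def d2_def PiE_iff swap intro!: restrict_ext)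
  then show ?thesis
    using group_C2 by (simp add: group_hom_def group_hom_axioms_def comm_group_def C3_def M.group_axioms)
qed

lemma d1_hom: "group_hom (C1 G M) (C2 G M) (d1 G M)"
proof -
  have "d1 G M \<in> hom (C1 G M) (C2 G M)"
    by (rule homI)
      (auto simp: C1_def C2_def d1_def PiE_iff M.inv_mult M.m_ac intro!: restrict_ext)
  then show ?thesis
    using group_C2 by (simp add: group_hom_def group_hom_axioms_def comm_group_def C1_def M.group_axioms)
qed

lemma d2_d1: assumes "c \<in> carrier (C1 G M)" shows "d2 G M (d1 G M c) = \<one>\<^bsub>C3 G M\<^esub>"
proof -
  have c: "c g \<in> carrier M" if "g \<in> carrier G" for g
    using assms that by (auto simp: C1_def)
  have cancel: "(a \<otimes>\<^bsub>M\<^esub> inv\<^bsub>M\<^esub> b \<otimes>\<^bsub>M\<^esub> p) \<otimes>\<^bsub>M\<^esub> inv\<^bsub>M\<^esub> (a \<otimes>\<^bsub>M\<^esub> inv\<^bsub>M\<^esub> q \<otimes>\<^bsub>M\<^esub> r)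
      \<otimes>\<^bsub>M\<^esub> (b \<otimes>\<^bsub>M\<^esub> inv\<^bsub>M\<^esub> q \<otimes>\<^bsub>M\<^esub> s) \<otimes>\<^bsub>M\<^esub> inv\<^bsub>M\<^esub> (p \<otimes>\<^bsub>M\<^esub> inv\<^bsub>M\<^esub> r \<otimes>\<^bsub>M\<^esub> s) = \<one>\<^bsub>M\<^esub>"
    if "a \<in> carrier M" "b \<in> carrier M" "p \<in> carrier M" "q \<in> carrier M" "r \<in> carrier M"
      "s \<in> carrier M" for a b p q r s
  proof -
    have l: "x \<otimes>\<^bsub>M\<^esub> (inv\<^bsub>M\<^esub> x \<otimes>\<^bsub>M\<^esub> y) = y" if "x \<in> carrier M" "y \<in> carrier M" for x y
      using that by (simp flip: M.m_assoc)
    have "(a \<otimes>\<^bsub>M\<^esub> inv\<^bsub>M\<^esub> b \<otimes>\<^bsub>M\<^esub> p) \<otimes>\<^bsub>M\<^esub> inv\<^bsub>M\<^esub> (a \<otimes>\<^bsub>M\<^esub> inv\<^bsub>M\<^esub> q \<otimes>\<^bsub>M\<^esub> r)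
      \<otimes>\<^bsub>M\<^esub> (b \<otimes>\<^bsub>M\<^esub> inv\<^bsub>M\<^esub> q \<otimes>\<^bsub>M\<^esub> s) \<otimes>\<^bsub>M\<^esub> inv\<^bsub>M\<^esub> (p \<otimes>\<^bsub>M\<^esub> inv\<^bsub>M\<^esub> r \<otimes>\<^bsub>M\<^esub> s)
      = (a \<otimes>\<^bsub>M\<^esub> (inv\<^bsub>M\<^esub> a \<otimes>\<^bsub>M\<^esub> (b \<otimes>\<^bsub>M\<^esub> (inv\<^bsub>M\<^esub> b \<otimes>\<^bsub>M\<^esub> (p \<otimes>\<^bsub>M\<^esub> (inv\<^bsub>M\<^esub> p \<otimes>\<^bsub>M\<^esub>
        (q \<otimes>\<^bsub>M\<^esub> (inv\<^bsub>M\<^esub> q \<otimes>\<^bsub>M\<^esub> (r \<otimes>\<^bsub>M\<^esub> (inv\<^bsub>M\<^esub> r \<otimes>\<^bsub>M\<^esub> (s \<otimes>\<^bsub>M\<^esub> inv\<^bsub>M\<^esub> s)))))))))))"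
      using that by (simp add: M.inv_mult M.m_ac del: M.r_inv M.Units_r_inv)
    also have "\<dots> = \<one>\<^bsub>M\<^esub>"
      using that by (simp add: l)
    finally show ?thesis .
  qed
  show ?thesis
  proof
    fix t
    show "d2 G M (d1 G M c) t = \<one>\<^bsub>C3 G M\<^esub> t"
    proof (cases "t \<in> carrier G \<times> carrier G \<times> carrier G")
      case True
      then obtain g h k where t: "t = (g, h, k)" "g \<in> carrier G" "h \<in> carrier G" "k \<in> carrier G"
        by auto
      have "gact M g (gact M h (c k) \<otimes>\<^bsub>M\<^esub> inv\<^bsub>M\<^esub> c (h \<otimes> k) \<otimes>\<^bsub>M\<^esub> c h)
          = gact M (g \<otimes> h) (c k) \<otimes>\<^bsub>M\<^esub> inv\<^bsub>M\<^esub> gact M g (c (h \<otimes> k)) \<otimes>\<^bsub>M\<^esub> gact M g (c h)"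
        using t by (simp add: c gact_mult)
      then show ?thesis
        using t cancel[of "gact M (g \<otimes> h) (c k)" "gact M g (c (h \<otimes> k))" "gact M g (c h)"
            "c (g \<otimes> h \<otimes> k)" "c (g \<otimes> h)" "c g"]
        by (simp add: C3_def d1_def d2_def c m_assoc)
    qed (auto simp: C3_def d2_def)
  qed
qed

lemma subgroup_Z2: "subgroup (Z2 G M) (C2 G M)"
  unfolding Z2_def by (rule group_hom.subgroup_kernel[OF d2_hom])

lemma subgroup_B2: "subgroup (B2 G M) (C2 G M)"
  unfolding B2_def by (rule group_hom.img_is_subgroup[OF d1_hom])

lemma B2_subset_Z2: "B2 G M \<subseteq> Z2 G M"
proof
  fix x assume "x \<in> B2 G M"
  then obtain c where c: "c \<in> carrier (C1 G M)" "x = d1 G M c" by (auto simp: B2_def)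
  then show "x \<in> Z2 G M"
    using d2_d1[OF c(1)] group_hom.hom_closed[OF d1_hom c(1)] by (simp add: Z2_def kernel_def)
qed

lemma H2_comm_group: "comm_group (H2 G M)"
proof -
  interpret C: comm_group "C2 G M" by (rule group_C2)
  have "comm_group ((C2 G M)\<lparr>carrier := Z2 G M\<rparr>)"
    by (rule group.group_comm_groupI[OF C.subgroup_imp_group[OF subgroup_Z2]])
      (simp add: C.m_comm subgroup.mem_carrier[OF subgroup_Z2])
  moreover have "subgroup (B2 G M) ((C2 G M)\<lparr>carrier := Z2 G M\<rparr>)"
    by (rule C.subgroup_incl[OF subgroup_B2 subgroup_Z2 B2_subset_Z2])
  ultimately show ?thesis
    unfolding H2_def by (rule comm_group.abelian_FactGroup)
qed

lemma res2_coset: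
  assumes D: "subgroup D G" and f: "f \<in> Z2 G M"
  shows "restrict f (D \<times> D) \<in> Z2 (G\<lparr>carrier := D\<rparr>) M"
    and "res2 G M D (B2 G M #>\<^bsub>C2 G M\<^esub> f)
       = B2 (G\<lparr>carrier := D\<rparr>) M #>\<^bsub>C2 (G\<lparr>carrier := D\<rparr>) M\<^esub> restrict f (D \<times> D)"
proof -
  let ?D = "G\<lparr>carrier := D\<rparr>" and ?r = "\<lambda>f::'g \<times> 'g \<Rightarrow> 'm. restrict f (D \<times> D)"
  interpret D: G_module ?D M by (rule G_module_subgroup[OF D])
  interpret C: comm_group "C2 G M" by (rule group_C2)
  interpret CD: comm_group "C2 ?D M" by (rule D.group_C2)
  note [simp] = subgroup.mem_carrier[OF D] subgroup.m_closed[OF D]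
  have r: "?r x \<in> Z2 ?D M" if "x \<in> Z2 G M" for x
  proof -
    have eq: "d2 G M x t = \<one>\<^bsub>C3 G M\<^esub> t" for t
      using that by (simp add: Z2_def kernel_def)
    have "d2 ?D M (?r x) = \<one>\<^bsub>C3 ?D M\<^esub>"
    proof
      fix t show "d2 ?D M (?r x) t = \<one>\<^bsub>C3 ?D M\<^esub> t"
        using eq[of t] by (cases t) (auto simp: d2_def C3_def restrict_def split: if_splits)
    qed
    moreover have "?r x \<in> carrier (C2 ?D M)"
      using that by (auto simp: Z2_def kernel_def C2_def PiE_iff)
    ultimately show ?thesis by (simp add: Z2_def kernel_def)
  qed
  then show "?r f \<in> Z2 ?D M" using f by blast
  have b: "?r x \<in> B2 ?D M" if "x \<in> B2 G M" for x
  proof -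
    from that obtain c where c: "c \<in> carrier (C1 G M)" "x = d1 G M c" by (auto simp: B2_def)
    have "restrict c D \<in> carrier (C1 ?D M)"
      using c(1) by (auto simp: C1_def PiE_iff)
    moreover have "?r x = d1 ?D M (restrict c D)"
      by (auto simp: c(2) d1_def intro!: restrict_ext)
    ultimately show ?thesis by (auto simp: B2_def)
  qed
  have m: "?r (x \<otimes>\<^bsub>C2 G M\<^esub> y) = ?r x \<otimes>\<^bsub>C2 ?D M\<^esub> ?r y" for x y
    by (auto simp: C2_def intro!: restrict_ext)
  have fD: "?r f \<in> carrier (C2 ?D M)"
    using r[OF f] subgroup.mem_carrier[OF D.subgroup_Z2] by blast
  have *: "B2 ?D M #>\<^bsub>C2 ?D M\<^esub> ?r y = B2 ?D M #>\<^bsub>C2 ?D M\<^esub> ?r f"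
    if y: "y \<in> B2 G M #>\<^bsub>C2 G M\<^esub> f" for y
  proof -
    from y obtain x where x: "x \<in> B2 G M" "y = x \<otimes>\<^bsub>C2 G M\<^esub> f" by (auto simp: r_coset_def)
    have "?r y \<in> B2 ?D M #>\<^bsub>C2 ?D M\<^esub> ?r f"
      using b[OF x(1)] by (auto simp: x(2) m r_coset_def)
    then show ?thesis
      using CD.repr_independence[OF _ fD D.subgroup_B2] by simp
  qed
  have "f \<in> B2 G M #>\<^bsub>C2 G M\<^esub> f"
    using C.rcos_self[OF _ subgroup_B2] f subgroup.mem_carrier[OF subgroup_Z2] by blast
  then show "res2 G M D (B2 G M #>\<^bsub>C2 G M\<^esub> f) = B2 ?D M #>\<^bsub>C2 ?D M\<^esub> ?r f"
    unfolding res2_def using * by blast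
qed

end

lemma (in group) G_module_Ind:
  assumes "subgroup H G"
  shows "G_module G (Ind G H)"
proof -
  note [simp] = subgroup.mem_carrier[OF assms]
  have "comm_group (Ind G H)"
  proof (rule comm_groupI)
    fix x assume "x \<in> carrier (Ind G H)"
    then show "\<exists>y\<in>carrier (Ind G H). y \<otimes>\<^bsub>Ind G H\<^esub> x = \<one>\<^bsub>Ind G H\<^esub>"
      by (intro bexI[of _ "\<lambda>t\<in>carrier G. - x t"]) (auto simp: Ind_def intro!: restrict_ext)
  qed (auto simp: Ind_def PiE_iff extensional_def fun_eq_iff)
  then show ?thesis
    by (auto simp: G_module_def G_module_axioms_def group_axioms hom_def Ind_def PiE_iff
        extensional_def fun_eq_iff m_assoc)
qed

lemma comm_group_fields:
  assumes "comm_group A" "carrier B = carrier A" "monoid.mult B = monoid.mult A" "one B = one A"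
  shows "comm_group B"
proof -
  interpret comm_group A by fact
  show ?thesis
    by (rule comm_groupI) (simp_all add: assms(2-4) m_ac l_inv_ex)
qed

lemma (in group) G_module_sum:
  assumes M: "\<And>i. i \<in> I \<Longrightarrow> G_module G (M i)"
  shows "G_module G (sum_gmodule I M)"
proof -
  have g: "group (M i)" and cg: "comm_group (M i)" if "i \<in> I" for i
    using M[OF that] by (auto simp: G_module_def comm_group_def)
  have one: "gact (M i) g \<one>\<^bsub>M i\<^esub> = \<one>\<^bsub>M i\<^esub>" if "i \<in> I" "g \<in> carrier G" for i g
    using hom_one[OF G_module.gact_hom[OF M[OF that(1)] that(2)]] g that by blast
  interpret S: group "sum_group I M" by (simp add: g)
  have cs: "comm_group (sum_group I M)"
    by (rule S.group_comm_groupI)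
      (auto simp: carrier_sum_group g PiE_iff comm_monoid.m_comm[OF comm_group.axioms(1)[OF cg]] intro!: restrict_ext)
  have "comm_group (sum_gmodule I M)"
    by (rule comm_group_fields[OF cs]) (simp_all add: sum_gmodule_def)
  moreover have "finite {i \<in> I. gact (M i) g (x i) \<noteq> \<one>\<^bsub>M i\<^esub>}"
    if "finite {i \<in> I. x i \<noteq> \<one>\<^bsub>M i\<^esub>}" "g \<in> carrier G" for x g
    by (rule finite_subset[OF _ that(1)]) (use one that in auto)
  ultimately show ?thesis
    by (auto simp: G_module_def G_module_axioms_def group_axioms hom_def sum_gmodule_def
        carrier_sum_group g PiE_iff G_module.gact_closed[OF M] G_module.gact_prod[OF M]
        G_module.gact_one[OF M] G_module.gact_mult[OF M] extensional_def fun_eq_iff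
        group.is_monoid cong: conj_cong)
qed

lemma (in G_module) G_module_coker:
  assumes f: "f \<in> hom A M" and A: "group A"
    and inv: "\<And>g a. \<lbrakk>g \<in> carrier G; a \<in> carrier A\<rbrakk> \<Longrightarrow> gact M g (f a) = f a"
  shows "G_module G (coker_gmodule A M f)"
proof -
  let ?B = "f ` carrier A"
  have B: "subgroup ?B M"
    using f A by (intro group_hom.img_is_subgroup) (simp add: group_hom_def group_hom_axioms_def M.group_axioms)
  have N: "?B \<lhd> M" using B by (rule M.subgroup_imp_normal)
  interpret Q: comm_group "M Mod ?B" by (rule M.abelian_FactGroup[OF B])
  have act: "gact M g ` (?B #>\<^bsub>M\<^esub> m) = ?B #>\<^bsub>M\<^esub> gact M g m"
    if "g \<in> carrier G" "m \<in> carrier M" for g m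
    using that hom_in_carrier[OF f] by (auto simp: r_coset_def inv image_UN image_iff)
  have car: "carrier (M Mod ?B) = (\<lambda>m. ?B #>\<^bsub>M\<^esub> m) ` carrier M"
    by (auto simp: FactGroup_def RCOSETS_def)
  have "comm_group (coker_gmodule A M f)"
    by (rule comm_group_fields[OF Q.comm_group_axioms]) (simp_all add: coker_gmodule_def)
  moreover have "gact (coker_gmodule A M f) g \<in> hom (coker_gmodule A M f) (coker_gmodule A M f)"
    if g: "g \<in> carrier G" for g
  proof (rule homI)
    fix X Y assume "X \<in> carrier (coker_gmodule A M f)" "Y \<in> carrier (coker_gmodule A M f)"
    then obtain m n where mn: "m \<in> carrier M" "X = ?B #>\<^bsub>M\<^esub> m" "n \<in> carrier M" "Y = ?B #>\<^bsub>M\<^esub> n"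
      by (auto simp: coker_gmodule_def car)
    have "gact M g ` (X <#>\<^bsub>M\<^esub> Y) = ?B #>\<^bsub>M\<^esub> gact M g (m \<otimes>\<^bsub>M\<^esub> n)"
      using mn g by (simp only: normal.rcos_sum[OF N] act M.m_closed)
    also have "\<dots> = (gact M g ` X) <#>\<^bsub>M\<^esub> (gact M g ` Y)"
      using mn g by (simp only: normal.rcos_sum[OF N] act gact_closed gact_prod)
    finally show "gact (coker_gmodule A M f) g (X \<otimes>\<^bsub>coker_gmodule A M f\<^esub> Y)
        = gact (coker_gmodule A M f) g X \<otimes>\<^bsub>coker_gmodule A M f\<^esub> gact (coker_gmodule A M f) g Y"
      by (simp add: coker_gmodule_def)
  qed (auto simp: coker_gmodule_def car act g)
  moreover have "gact (coker_gmodule A M f) \<one> X = X" if "X \<in> carrier (coker_gmodule A M f)" for X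
  proof -
    from that obtain m where "m \<in> carrier M" "X = ?B #>\<^bsub>M\<^esub> m"
      by (auto simp: coker_gmodule_def car)
    then show ?thesis by (simp add: coker_gmodule_def act gact_one)
  qed
  moreover have "gact (coker_gmodule A M f) (g \<otimes> h) X
      = gact (coker_gmodule A M f) g (gact (coker_gmodule A M f) h X)"
    if "g \<in> carrier G" "h \<in> carrier G" "X \<in> carrier (coker_gmodule A M f)" for g h X
  proof -
    from that obtain m where "m \<in> carrier M" "X = ?B #>\<^bsub>M\<^esub> m"
      by (auto simp: coker_gmodule_def car)
    then show ?thesis using that by (simp add: coker_gmodule_def act gact_mult)
  qed
  ultimately show ?thesis
    by (simp add: G_module_def G_module_axioms_def group_axioms)
qed

lemma (in group) G_module_J:
  assumes "\<And>H. H \<in># \<H> \<Longrightarrow> subgroup H G"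
  shows "G_module G (J_module G \<H>)"
proof -
  have I: "G_module G (case p of (H, _) \<Rightarrow> Ind G H)" if "p \<in> mset_index \<H>" for p
    using that assms by (auto simp: mset_index_def intro!: G_module_Ind)
  then have g: "group (case p of (H, _) \<Rightarrow> Ind G H)" if "p \<in> mset_index \<H>" for p
    using that by (auto simp: G_module_def comm_group_def)
  interpret S: G_module G "sum_Ind G \<H>"
    unfolding sum_Ind_def by (rule G_module_sum) (rule I)
  have fin: "finite (mset_index \<H>)" by (simp add: mset_index_def)
  have H: "subgroup (fst p) G" if "p \<in> mset_index \<H>" for p
    using that assms by (auto simp: mset_index_def)
  show ?thesis
    unfolding J_module_def
  proof (rule S.G_module_coker)
    show "const_Ind G \<H> \<in> hom integer_group (sum_Ind G \<H>)"
    proof (rule homI)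
      fix n
      have "(\<lambda>x\<in>carrier G. n) \<in> carrier (Ind G H)" if "(H, i) \<in> mset_index \<H>" for H i
        using subgroup.mem_carrier[OF H[OF that]] by (auto simp: Ind_def)
      then show "const_Ind G \<H> n \<in> carrier (sum_Ind G \<H>)"
        using fin by (auto simp: sum_Ind_def sum_gmodule_def const_Ind_def carrier_sum_group[OF g])
    qed (auto simp: sum_Ind_def sum_gmodule_def const_Ind_def Ind_def split_beta intro!: restrict_ext)
  qed (auto simp: const_Ind_def sum_Ind_def sum_gmodule_def Ind_def split_beta intro!: restrict_ext)
qed

end

theory Submission
  imports Defs "HOL-Algebra.Multiplicative_Group" "HOL-Combinatorics.Cycles"
begin

text \<open>
  Let \<open>C\<close> be the subgroup generated by \<open>c\<close>, of order \<open>n\<close>. The class of a cocycle \<open>f\<close> in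
  $H^2(C, J) = J^C / N_C J$ is that of the sum \<open>s\<close> of the \<open>f (c^i, c)\<close>, and the class of its
  restriction to a subgroup \<open>C'\<close> of \<open>C\<close> is that of the same \<open>s\<close> modulo $N_{C'} J$.
  Now \<open>J\<close> consists of the integer functions on the \<open>G\<close>-set \<open>X\<close>, the disjoint union of the
  \<open>H\G\<close>, modulo constants. Lifting \<open>s\<close> to a \<open>C\<close>-invariant function on \<open>X\<close>, it is a norm from \<open>C\<close>
  modulo constants if and only if some integer \<open>k\<close> satisfies \<open>s x = k\<close> modulo the order of the
  stabilizer $C_x$ for all \<open>x\<close>. Such a stabilizer is conjugate to a cyclic subgroup of a member of
  \<open>\<H>\<close>, so \<open>f\<close> is trivial on it; evaluated at \<open>x\<close> and \<open>y\<close>, this gives \<open>s x = s y\<close> modulo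
  $\gcd(|C_x|, |C_y|)$. The Chinese remainder theorem then provides \<open>k\<close>.
\<close>

section \<open>Norms on functions on a finite cyclic set\<close>

lemma gcd_lcm_dvd_int:
  fixes a b c x :: int
  assumes "gcd a c dvd x" "gcd b c dvd x"
  shows "gcd (lcm a b) c dvd x"
proof (cases "a = 0 \<and> b = 0")
  case True
  then show ?thesis using assms by simp
next
  case False
  define g where "g = gcd a b"
  have "g \<noteq> 0" using False by (simp add: g_def)
  obtain a' b' where ab: "a = a' * g" "b = b' * g" "coprime a' b'"
    using \<open>g \<noteq> 0\<close> gcd_coprime_exists[of a b] unfolding g_def by blast
  then obtain u v where uv: "u * a' + v * b' = 1"
    using bezout_int[of a' b'] by auto
  have "lcm a b dvd a' * b"
    using ab by (intro lcm_least) auto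
  then have G: "gcd (lcm a b) c dvd a' * b" "gcd (lcm a b) c dvd c"
    by (meson gcd_dvd1 dvd_trans, simp)
  obtain p q where pq: "x = p * a + q * c"
  proof -
    obtain t where "x = gcd a c * t" using assms(1) by (elim dvdE)
    moreover obtain i j where "i * a + j * c = gcd a c" using bezout_int by blast
    ultimately have "x = (i * a + j * c) * t" by simp
    then show thesis by (intro that[of "i * t" "j * t"]) (simp add: algebra_simps)
  qed
  obtain p' q' where pq': "x = p' * b + q' * c"
  proof -
    obtain t where "x = gcd b c * t" using assms(2) by (elim dvdE)
    moreover obtain i j where "i * b + j * c = gcd b c" using bezout_int by blast
    ultimately have "x = (i * b + j * c) * t" by simp
    then show thesis by (intro that[of "i * t" "j * t"]) (simp add: algebra_simps)
  qed
  \<comment> \<open>The representation of \<open>x\<close> by \<open>b\<close> and \<open>c\<close>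
    is paired with \<open>a'\<close>, that by \<open>a\<close> and \<open>c\<close> with
    \<open>b'\<close>: both \<open>a' * b\<close> and \<open>b' * a\<close> equal
    \<open>a' * b' * g\<close>, a multiple of \<open>lcm a b\<close>.\<close>
  have "x = u * a' * (p' * b + q' * c) + v * b' * (p * a + q * c)"
    using uv by (metis pq pq' distrib_right mult_1)
  also have "\<dots> = (u * p' + v * p) * (a' * b) + (u * a' * q' + v * b' * q) * c"
    by (simp add: ab algebra_simps)
  finally show ?thesis using G by (metis dvd_add dvd_mult)
qed

text \<open>\<open>L\<close> is the iterated lcm. Its second property lets a new modulus
  \<open>c\<close> be compared with all \<open>m i\<close> at once.\<close>

lemma gcd_common_multiple_dvd_int:
  fixes m :: "'i \<Rightarrow> int"
  assumes "finite A"
  shows "\<exists>L. (\<forall>i\<in>A. m i dvd L) \<and> (\<forall>x c. (\<forall>i\<in>A. gcd (m i) c dvd x) \<longrightarrow> gcd L c dvd x)"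
  using assms
proof (induction A)
  case (insert r A)
  then obtain L where L: "\<forall>i\<in>A. m i dvd L" "\<forall>x c. (\<forall>i\<in>A. gcd (m i) c dvd x) \<longrightarrow> gcd L c dvd x"
    by blast
  show ?case
    by (rule exI[of _ "lcm (m r) L"]) (use L gcd_lcm_dvd_int in \<open>auto intro: dvd_lcmI2\<close>)
qed (rule exI[of _ 1], simp)

text \<open>Induction on \<open>A\<close>: a solution \<open>k\<close> of the old congruences is
  corrected by a multiple of \<open>L\<close>, which is possible since
  \<open>gcd (m i) (m r)\<close> divides \<open>a i - a r\<close> and \<open>a i - k\<close>, hence
  \<open>a r - k\<close>.\<close>

lemma pairwise_chinese_remainder_int:
  fixes m a :: "'i \<Rightarrow> int"
  assumes "finite A" and "\<And>i j. \<lbrakk>i \<in> A; j \<in> A\<rbrakk> \<Longrightarrow> gcd (m i) (m j) dvd a i - a j"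
  shows "\<exists>k. \<forall>i\<in>A. m i dvd a i - k"
  using assms
proof (induction A)
  case (insert r A)
  have "\<exists>k. \<forall>i\<in>A. m i dvd a i - k" by (rule insert.IH) (rule insert.prems; simp)
  then obtain k where k: "\<forall>i\<in>A. m i dvd a i - k" by blast
  obtain L where L: "\<forall>i\<in>A. m i dvd L" "\<forall>x c. (\<forall>i\<in>A. gcd (m i) c dvd x) \<longrightarrow> gcd L c dvd x"
    using gcd_common_multiple_dvd_int[OF insert.hyps(1), of m] by (elim exE conjE)
  have "gcd (m i) (m r) dvd a r - k" if "i \<in> A" for i
  proof -
    have "gcd (m i) (m r) dvd a i - a r" by (rule insert.prems) (use that in auto)
    moreover have "gcd (m i) (m r) dvd a i - k" using k that by (meson dvd_trans gcd_dvd1)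
    ultimately have "gcd (m i) (m r) dvd (a i - k) - (a i - a r)" by (rule dvd_diff[rotated])
    then show ?thesis by simp
  qed
  then have "gcd L (m r) dvd a r - k" using L(2) by blast
  then obtain t where t: "a r - k = gcd L (m r) * t" by (elim dvdE)
  obtain u v where uv: "u * L + v * m r = gcd L (m r)" using bezout_int by blast
  have "m i dvd a i - (k + u * L * t)" if "i \<in> A" for i
  proof -
    have "m i dvd (a i - k) - u * L * t" using k L(1) that by (intro dvd_diff[OF _ dvd_mult2[OF dvd_mult]]) blast+
    then show ?thesis by (simp add: algebra_simps)
  qed
  moreover have "a r - (k + u * L * t) = m r * (v * t)"
    using t by (simp add: algebra_simps flip: uv)
  ultimately show ?case by (intro exI[of _ "k + u * L * t"]) auto
qed simp

section \<open>Sums along the iterates of a map of finite order\<close>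

lemma sum_lessThan_add:
  fixes f :: "nat \<Rightarrow> 'a::comm_monoid_add"
  shows "sum f {..<m + k} = sum f {..<m} + (\<Sum>i<k. f (m + i))"
  by (induction k) (simp_all add: add.assoc)

lemma sum_periodic:
  fixes f :: "nat \<Rightarrow> int"
  assumes "\<And>i. f (i + l) = f i"
  shows "(\<Sum>i<q * l. f i) = int q * (\<Sum>i<l. f i)"
proof (induction q)
  case (Suc q)
  have "f (q * l + i) = f i" for i
  proof (induction q)
    case (Suc q)
    then show ?case using assms[of "q * l + i"] by (simp add: add_ac)
  qed simp
  then show ?case using Suc sum_lessThan_add[of f "q * l" l] by (simp add: algebra_simps)
qed simp

lemma funpow_eq_iff_least_power:
  assumes "(\<sigma> ^^ n) x = x" "n > 0"
  shows "(\<sigma> ^^ i) x = x \<longleftrightarrow> least_power \<sigma> x dvd i"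
proof
  assume "least_power \<sigma> x dvd i"
  then obtain t where "i = t * least_power \<sigma> x" by (metis dvdE mult.commute)
  moreover have "(\<sigma> ^^ (t * least_power \<sigma> x)) x = x"
    by (induction t) (simp_all add: funpow_add least_powerI[OF assms])
  ultimately show "(\<sigma> ^^ i) x = x" by simp
qed (rule least_power_minimal)

text \<open>The formula in \<open>stab\<close> holds on all of \<open>X\<close>. For the stabilizer
  of \<open>x\<close> it can thus be evaluated at \<open>x\<close> and at \<open>y\<close>, which
  compares \<open>s x\<close> with \<open>s y\<close>. The common residue \<open>k\<close> then
  allows a norm supported on orbit representatives.\<close>

lemma invariant_function_is_norm:
  fixes \<sigma> :: "'x \<Rightarrow> 'x" and s :: "'x \<Rightarrow> int"
  assumes X: "finite X" and n: "n > 0"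
    and \<sigma>: "\<And>x. x \<in> X \<Longrightarrow> \<sigma> x \<in> X" "\<And>x. x \<in> X \<Longrightarrow> (\<sigma> ^^ n) x = x"
    and s: "\<And>x. x \<in> X \<Longrightarrow> s (\<sigma> x) = s x"
    and stab: "\<And>x d. \<lbrakk>x \<in> X; d dvd n; (\<sigma> ^^ d) x = x\<rbrakk> \<Longrightarrow>
      \<exists>k \<phi>. \<forall>y\<in>X. s y = k + (\<Sum>j<n div d. \<phi> ((\<sigma> ^^ (d * j)) y))"
  shows "\<exists>k \<phi>. \<forall>y\<in>X. s y = k + (\<Sum>j<n. \<phi> ((\<sigma> ^^ j) y))"
proof -
  \<comment> \<open>The orbit of \<open>x\<close> has \<open>least_power \<sigma> x\<close> points,
    so \<open>e x\<close> is the order of its stabilizer in the cyclic group of order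
    \<open>n\<close>.\<close>
  define e where "e x = n div least_power \<sigma> x" for x
  have lp: "least_power \<sigma> x dvd n" "least_power \<sigma> x > 0" "e x * least_power \<sigma> x = n"
    "(\<sigma> ^^ least_power \<sigma> x) x = x" if "x \<in> X" for x
    using funpow_eq_iff_least_power[OF \<sigma>(2)[OF that] n, of n] \<sigma>(2)[OF that] n
      least_powerI[of n \<sigma> x] by (auto simp: e_def)
  have iter: "(\<sigma> ^^ j) x \<in> X" "s ((\<sigma> ^^ j) x) = s x" if "x \<in> X" for x j
    using that by (induction j) (auto simp: \<sigma> s)
  have "gcd (int (e x)) (int (e y)) dvd s x - s y" if x: "x \<in> X" and y: "y \<in> X" for x y
  proof -
    let ?d = "least_power \<sigma> x" and ?d' = "least_power \<sigma> y"
    obtain k \<phi> where k: "\<And>y. y \<in> X \<Longrightarrow> s y = k + (\<Sum>j<e x. \<phi> ((\<sigma> ^^ (?d * j)) y))"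
      using stab[OF x lp(1,4)[OF x]] by (auto simp: e_def)
    have "(\<sigma> ^^ (?d * j)) x = x" for j
      using funpow_eq_iff_least_power[OF \<sigma>(2)[OF x] n] by simp
    then have "s x = k + int (e x) * \<phi> x" using k[OF x] by simp
    then have 1: "gcd (int (e x)) (int (e y)) dvd s x - k" by simp
    \<comment> \<open>\<open>l\<close> is the size of the orbit of \<open>y\<close> under
      \<open>\<sigma> ^^ ?d\<close>. It turns out that \<open>e x = q * l\<close> and that
      \<open>q\<close> is the gcd of \<open>e x\<close> and \<open>e y\<close>; the norm at
      \<open>y\<close> runs \<open>q\<close> times through a period, so \<open>q\<close> divides
      it.\<close>
    define l where "l = ?d' div gcd ?d ?d'"
    have lcm: "?d * l = lcm ?d ?d'"
      by (simp add: l_def lcm_nat_def div_mult_swap)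
    obtain q where q: "n = lcm ?d ?d' * q"
      using lp(1)[OF x] lp(1)[OF y] by (meson lcm_least dvdE)
    have "?d * (l * q) = n" unfolding q lcm[symmetric] by simp
    then have ex: "e x = q * l"
      using lp(3)[OF x] lp(2)[OF x] by (metis mult.commute mult_right_cancel not_gr_zero)
    have "?d' * ((?d div gcd ?d ?d') * q) = n"
      unfolding q by (simp add: lcm_nat_def dvd_div_mult div_mult_swap mult.commute mult.left_commute)
    then have ey: "e y = (?d div gcd ?d ?d') * q"
      using lp(3)[OF y] lp(2)[OF y] by (metis mult.commute mult_right_cancel not_gr_zero)
    have "gcd (e x) (e y) = q * gcd l (?d div gcd ?d ?d')"
      unfolding ex ey by (metis gcd_mult_distrib_nat mult.commute)
    also have "gcd l (?d div gcd ?d ?d') = 1"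
    proof -
      have "coprime (?d div gcd ?d ?d') l"
        unfolding l_def by (rule div_gcd_coprime) (use lp(2)[OF x] in simp)
      then show ?thesis by (metis coprime_iff_gcd_eq_1 gcd.commute)
    qed
    finally have g: "gcd (int (e x)) (int (e y)) = int q" by simp
    have "\<phi> ((\<sigma> ^^ (?d * (j + l))) y) = \<phi> ((\<sigma> ^^ (?d * j)) y)" for j
    proof -
      have "(\<sigma> ^^ (?d * l)) y = y"
        using funpow_eq_iff_least_power[OF \<sigma>(2)[OF y] n] by (simp add: lcm)
      then show ?thesis by (simp add: distrib_left funpow_add)
    qed
    from sum_periodic[of "\<lambda>j. \<phi> ((\<sigma> ^^ (?d * j)) y)", OF this, of q]
    have "gcd (int (e x)) (int (e y)) dvd s y - k" unfolding g using k[OF y] by (simp add: ex)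
    with 1 have "gcd (int (e x)) (int (e y)) dvd (s x - k) - (s y - k)" by (rule dvd_diff)
    then show ?thesis by simp
  qed
  from pairwise_chinese_remainder_int[of X "\<lambda>x. int (e x)" s, OF X this]
  obtain k where k: "\<And>x. x \<in> X \<Longrightarrow> int (e x) dvd s x - k" by blast
  have fa: "(\<sigma> ^^ (i + j)) x = (\<sigma> ^^ i) ((\<sigma> ^^ j) x)" for i j x
    by (simp add: funpow_add)
  have comm: "(\<sigma> ^^ i) ((\<sigma> ^^ j) x) = (\<sigma> ^^ j) ((\<sigma> ^^ i) x)" for i j x
    unfolding fa[symmetric] by (simp only: add.commute)
  define orb where "orb x = range (\<lambda>j. (\<sigma> ^^ j) x)" for x
  have orb: "orb ((\<sigma> ^^ j) x) = orb x" if x: "x \<in> X" for x j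
  proof -
    have "(\<sigma> ^^ i) x \<in> orb ((\<sigma> ^^ j) x)" for i
    proof -
      have "(\<sigma> ^^ (n * j)) x = x"
        using funpow_eq_iff_least_power[OF \<sigma>(2)[OF x] n] lp(1)[OF x] by simp
      then have "(\<sigma> ^^ i) x = (\<sigma> ^^ (i + n * j)) x" by (simp add: funpow_add)
      \<comment> \<open>Going back \<open>j\<close> steps is going forward
        \<open>(n - 1) * j\<close> steps.\<close>
      also have "i + n * j = (i + (n - 1) * j) + j" using n by (cases n) auto
      finally have "(\<sigma> ^^ i) x = (\<sigma> ^^ (i + (n - 1) * j)) ((\<sigma> ^^ j) x)" by (simp only: fa)
      then show ?thesis unfolding orb_def by blast
    qed
    moreover have "(\<sigma> ^^ i) ((\<sigma> ^^ j) x) \<in> orb x" for i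
      unfolding orb_def fa[symmetric] by blast
    ultimately show ?thesis unfolding orb_def by blast
  qed
  \<comment> \<open>The choice depends on the orbit as a set only, so all its points share one
    representative, which carries \<open>\<phi>\<close>. The \<open>n\<close> iterates meet it
    \<open>e x\<close> times, whence the quotient.\<close>
  define rep where "rep x = (SOME r. r \<in> orb x)" for x
  define \<phi> where "\<phi> x = (if x = rep x then (s x - k) div int (e x) else 0)" for x
  have "s y = k + (\<Sum>j<n. \<phi> ((\<sigma> ^^ j) y))" if y: "y \<in> X" for y
  proof -
    let ?d = "least_power \<sigma> y"
    have "rep y \<in> orb y" unfolding rep_def orb_def by (rule someI[of _ "(\<sigma> ^^ 0) y"]) blast
    then obtain i where "rep y = (\<sigma> ^^ i) y" unfolding orb_def by blast
    then have i: "rep y = (\<sigma> ^^ (i mod ?d)) y" using lp(4)[OF y] by (simp add: funpow_mod_eq)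
    have r: "rep ((\<sigma> ^^ j) y) = rep y" for j by (simp add: rep_def orb[OF y])
    have inj: "(\<sigma> ^^ j) y = (\<sigma> ^^ i) y \<Longrightarrow> j = i" if "i \<le> j" "j < ?d" for i j
    proof -
      assume eq: "(\<sigma> ^^ j) y = (\<sigma> ^^ i) y"
      have "(\<sigma> ^^ (j + (?d - i))) y = (\<sigma> ^^ (i + (?d - i))) y"
        using eq by (simp only: fa comm[of _ "?d - i"])
      then have "(\<sigma> ^^ (j + (?d - i))) y = y" using that lp(4)[OF y] by simp
      then have "?d dvd j + (?d - i)" by (rule least_power_minimal)
      then have "?d dvd (j - i) + ?d" using that by (simp add: algebra_simps)
      then have "?d dvd j - i" by simp
      then show "j = i" using that by (auto dest: dvd_imp_le)
    qed
    have v: "\<phi> ((\<sigma> ^^ j) y) = (if j = i mod ?d then (s y - k) div int (e y) else 0)" if "j < ?d" for j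
    proof -
      have "(\<sigma> ^^ j) y = rep y \<longleftrightarrow> j = i mod ?d"
        using inj[of j "i mod ?d"] inj[of "i mod ?d" j] that lp(2)[OF y] i by (metis mod_less_divisor nat_le_linear)
      moreover have "e ((\<sigma> ^^ j) y) = e y"
      proof -
        have "(\<sigma> ^^ t) ((\<sigma> ^^ j) y) = (\<sigma> ^^ j) y \<longleftrightarrow> (\<sigma> ^^ t) y = y" for t
        proof
          assume a: "(\<sigma> ^^ t) ((\<sigma> ^^ j) y) = (\<sigma> ^^ j) y"
          have "(\<sigma> ^^ (?d - j)) ((\<sigma> ^^ j) y) = y"
            using that lp(4)[OF y] by (simp flip: fa)
          then show "(\<sigma> ^^ t) y = y" using a by (metis comm)
        qed (simp add: comm[of t])
        then show ?thesis by (simp add: e_def least_power_def)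
      qed
      ultimately show ?thesis unfolding \<phi>_def r iter(2)[OF y] by presburger
    qed
    have "\<phi> ((\<sigma> ^^ (j + ?d)) y) = \<phi> ((\<sigma> ^^ j) y)" for j by (simp add: funpow_add lp(4)[OF y])
    from sum_periodic[of "\<lambda>j. \<phi> ((\<sigma> ^^ j) y)", OF this, of "e y"]
    have "(\<Sum>j<n. \<phi> ((\<sigma> ^^ j) y)) = int (e y) * (\<Sum>j<?d. \<phi> ((\<sigma> ^^ j) y))" by (simp add: lp(3)[OF y])
    also have "(\<Sum>j<?d. \<phi> ((\<sigma> ^^ j) y)) = (s y - k) div int (e y)"
      using v lp(2)[OF y] by (simp add: sum.delta)
    also have "int (e y) * ((s y - k) div int (e y)) = s y - k" using k[OF y] by simp
    finally show ?thesis by simp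
  qed
  then show ?thesis by blast
qed


section \<open>Cocycles modulo constants\<close>

text \<open>Comparing two points avoids a name for the constant: identities modulo constants then
  combine by linear arithmetic.\<close>

definition const_on :: "'x set \<Rightarrow> ('x \<Rightarrow> int) \<Rightarrow> bool"
  where "const_on X u \<longleftrightarrow> (\<forall>x\<in>X. \<forall>y\<in>X. u x = u y)"

lemma const_onI: "(\<And>x y. \<lbrakk>x \<in> X; y \<in> X\<rbrakk> \<Longrightarrow> u x = u y) \<Longrightarrow> const_on X u"
  and const_onD: "\<lbrakk>const_on X u; x \<in> X; y \<in> X\<rbrakk> \<Longrightarrow> u x = u y"
  unfolding const_on_def by blast+

text \<open>
  \<open>F\<close> is an integer-valued lift of a 2-cocycle with values in functions on \<open>X\<close> modulo constants,
  so every cochain identity holds only up to a constant. The right action \<open>act\<close> of \<open>G\<close> on \<open>X\<close>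
  induces the left action on functions.
\<close>

locale cocycle_mod_const = group G for G (structure) +
  fixes X :: "'x set" and act :: "'x \<Rightarrow> 'a \<Rightarrow> 'x" and F :: "'a \<Rightarrow> 'a \<Rightarrow> 'x \<Rightarrow> int"
  assumes act_closed: "\<lbrakk>x \<in> X; g \<in> carrier G\<rbrakk> \<Longrightarrow> act x g \<in> X"
    and act_one: "x \<in> X \<Longrightarrow> act x \<one> = x"
    and act_mult: "\<lbrakk>x \<in> X; g \<in> carrier G; h \<in> carrier G\<rbrakk> \<Longrightarrow> act x (g \<otimes> h) = act (act x g) h"
    and cocycle: "\<lbrakk>g \<in> carrier G; h \<in> carrier G; k \<in> carrier G\<rbrakk> \<Longrightarrow>
      const_on X (\<lambda>x. F h k (act x g) - F (g \<otimes> h) k x + F g (h \<otimes> k) x - F g h x)"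
begin

definition splits :: "'a set \<Rightarrow> bool"
  where "splits D \<longleftrightarrow>
    (\<exists>\<beta>. \<forall>a\<in>D. \<forall>b\<in>D. const_on X (\<lambda>x. F a b x - \<beta> b (act x a) + \<beta> (a \<otimes> b) x - \<beta> a x))"

text \<open>Conjugation by an element of \<open>G\<close> acts trivially on classes that come from
  \<open>G\<close>, so triviality passes between conjugate subgroups.\<close>

lemma splits_conj:
  assumes g: "g \<in> carrier G" and D: "D \<subseteq> carrier G" and D': "\<And>a. a \<in> D \<Longrightarrow> g \<otimes> a \<otimes> inv g \<in> D'"
    and "splits D'"
  shows "splits D"
proof -
  obtain \<beta> where \<beta>: "\<And>a b. \<lbrakk>a \<in> D'; b \<in> D'\<rbrakk> \<Longrightarrow>
      const_on X (\<lambda>x. F a b x - \<beta> b (act x a) + \<beta> (a \<otimes> b) x - \<beta> a x)"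
    using \<open>splits D'\<close> by (auto simp: splits_def)
  \<comment> \<open>Conjugate the splitting over \<open>D'\<close> by the lift \<open>(0, g)\<close> of \<open>g\<close> to the extension defined by \<open>F\<close>.\<close>
  define E where "E a z = \<beta> (g \<otimes> a \<otimes> inv g) z - F (g \<otimes> a \<otimes> inv g) g z + F g a z" for a z
  define \<beta>' where "\<beta>' a x = E a (act x (inv g))" for a x
  have "const_on X (\<lambda>x. F a b x - \<beta>' b (act x a) + \<beta>' (a \<otimes> b) x - \<beta>' a x)" if ab: "a \<in> D" "b \<in> D" for a b
  proof -
    let ?A = "g \<otimes> a \<otimes> inv g" and ?B = "g \<otimes> b \<otimes> inv g"
    have [simp]: "a \<in> carrier G" "b \<in> carrier G" using ab D by auto
    note [simp] = g
    have r: "?A \<otimes> g = g \<otimes> a" "?B \<otimes> g = g \<otimes> b"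
      by (simp_all add: m_assoc)
    have AB: "g \<otimes> (a \<otimes> b) \<otimes> inv g = ?A \<otimes> ?B"
      by (simp add: m_assoc) (simp flip: m_assoc)
    have *: "F a b x - \<beta>' b (act x a) + \<beta>' (a \<otimes> b) x - \<beta>' a x =
        F a b (act z g) - E b (act z ?A) + E (a \<otimes> b) z - E a z" if "x \<in> X" "z = act x (inv g)" for x z
    proof -
      have "act z g = x" using that by (simp add: act_one flip: act_mult)
      moreover have "act (act x a) (inv g) = act z ?A"
      proof -
        have "act z ?A = act x (inv g \<otimes> ?A)" using that by (simp add: act_mult)
        also have "inv g \<otimes> ?A = a \<otimes> inv g" by (simp add: m_assoc) (simp flip: m_assoc)
        finally show ?thesis using that by (simp add: act_mult)
      qed
      ultimately show ?thesis using that by (simp add: \<beta>'_def)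
    qed
    show ?thesis
    proof (rule const_onI)
      fix x y assume xy: "x \<in> X" "y \<in> X"
      define z w where "z = act x (inv g)" and "w = act y (inv g)"
      have zw: "z \<in> X" "w \<in> X" using xy by (auto simp: z_def w_def act_closed)
      show "F a b x - \<beta>' b (act x a) + \<beta>' (a \<otimes> b) x - \<beta>' a x
          = F a b y - \<beta>' b (act y a) + \<beta>' (a \<otimes> b) y - \<beta>' a y"
        unfolding *[OF xy(1) z_def] *[OF xy(2) w_def]
        \<comment> \<open>The identity for \<open>(g, a, b)\<close> minus that for
          \<open>(?A, g, b)\<close> plus that for \<open>(?A, ?B, g)\<close> turns the expression in
          \<open>E\<close> into the one in \<open>\<beta>\<close> over \<open>D'\<close>.\<close>
        using const_onD[OF cocycle[of g a b] zw] const_onD[OF cocycle[of ?A g b] zw]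
          const_onD[OF cocycle[of ?A ?B g] zw] const_onD[OF \<beta>[OF D' D', OF ab] zw]
        by (simp add: E_def AB r)
    qed
  qed
  then show ?thesis unfolding splits_def by blast
qed

section \<open>Restriction of the cocycle to a cyclic subgroup\<close>

context
  fixes c assumes c: "c \<in> carrier G"
begin

text \<open>
  Pulled back to the monoid of exponents of \<open>c\<close>, the cocycle is the coboundary of \<open>bnd\<close>;
  \<open>total\<close> below measures the failure of \<open>bnd\<close> to be periodic.
\<close>

definition bnd :: "nat \<Rightarrow> 'x \<Rightarrow> int"
  where "bnd k x = F \<one> \<one> x - (\<Sum>i<k. F (c [^] i) c x)"

text \<open>Induction on \<open>j\<close> with the cocycle identity for \<open>c [^] i\<close>,
  \<open>c [^] j\<close>, \<open>c\<close>. The start needs the identity for \<open>c [^] i\<close>,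
  \<open>\<one>\<close>, \<open>\<one>\<close>, hence the term \<open>F \<one> \<one>\<close> in
  \<open>bnd\<close>.\<close>

lemma cocycle_pow_eq_coboundary:
  "const_on X (\<lambda>x. F (c [^] i) (c [^] j) x - bnd j (act x (c [^] i)) + bnd (i + j) x - bnd i x)"
proof (induction j)
  case 0
  show ?case
  proof (rule const_onI)
    fix x y assume "x \<in> X" "y \<in> X"
    from const_onD[OF cocycle[of "c [^] i" \<one> \<one>] this]
    show "F (c [^] i) (c [^] (0::nat)) x - bnd 0 (act x (c [^] i)) + bnd (i + 0) x - bnd i x
      = F (c [^] i) (c [^] (0::nat)) y - bnd 0 (act y (c [^] i)) + bnd (i + 0) y - bnd i y"
      using c by (simp add: bnd_def)
  qed
next
  case (Suc j)
  show ?case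
  proof (rule const_onI)
    fix x y assume xy: "x \<in> X" "y \<in> X"
    have "c [^] i \<otimes> c [^] j = c [^] (i + j)" using c by (simp add: nat_pow_mult)
    then show "F (c [^] i) (c [^] Suc j) x - bnd (Suc j) (act x (c [^] i)) + bnd (i + Suc j) x - bnd i x
      = F (c [^] i) (c [^] Suc j) y - bnd (Suc j) (act y (c [^] i)) + bnd (i + Suc j) y - bnd i y"
      using const_onD[OF cocycle[of "c [^] i" "c [^] j" c] xy] const_onD[OF Suc xy] c
      by (simp add: bnd_def)
  qed
qed

lemma act_pow: "x \<in> X \<Longrightarrow> act x (c [^] (i + j :: nat)) = act (act x (c [^] i)) (c [^] j)"
  unfolding nat_pow_mult[OF c, symmetric] using c by (simp add: act_mult)

lemma funpow_act: "x \<in> X \<Longrightarrow> ((\<lambda>x. act x c) ^^ i) x = act x (c [^] i)"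
  using c by (induction i) (simp_all add: act_one act_mult)

context
  fixes n :: nat assumes n: "n > 0" "c [^] n = \<one>"
begin

definition total :: "'x \<Rightarrow> int"
  where "total x = (\<Sum>i<n. F (c [^] i) c x)"

lemma bnd_period: "bnd n x = bnd 0 x - total x"
  by (simp add: bnd_def total_def)

text \<open>Comparing the exponent pairs \<open>(1, n)\<close> and \<open>(n, 1)\<close> shows that
  \<open>c\<close> changes \<open>total\<close> by the same constant at every point. After
  \<open>n\<close> steps the old value is back, so this constant is 0, the integers being
  torsion-free.\<close>

lemma total_invariant:
  assumes "x \<in> X" shows "total (act x c) = total x"
proof -
  have *: "total (act x c) - total x = total (act y c) - total y" if xy: "x \<in> X" "y \<in> X" for x y
    using const_onD[OF cocycle_pow_eq_coboundary[of 1 n] xy] const_onD[OF cocycle_pow_eq_coboundary[of n 1] xy]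
      const_onD[OF cocycle_pow_eq_coboundary[of 1 0] xy] const_onD[OF cocycle_pow_eq_coboundary[of 0 1] xy] xy c n
    by (simp add: bnd_period act_one add.commute)
  have "total (act x (c [^] i)) = total x + int i * (total (act x c) - total x)" for i
  proof (induction i)
    case (Suc i)
    have "act x (c [^] i) \<in> X" using assms c by (simp add: act_closed)
    with *[OF this assms] Suc show ?case using c assms by (simp add: act_mult algebra_simps)
  qed (simp add: act_one assms)
  from this[of n] show ?thesis using n assms by (simp add: act_one)
qed

text \<open>On the powers of \<open>c [^] d\<close> both \<open>bnd\<close> and
  \<open>\<beta>\<close> split the cocycle, so their difference \<open>T\<close> is a crossed
  homomorphism modulo constants and telescopes to the norm of \<open>T 1\<close>. Since
  \<open>\<beta>\<close> depends on the group element alone, \<open>T\<close> changes by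
  \<open>- total\<close> over a full period.\<close>

lemma total_eq_norm_if_splits:
  assumes "d dvd n" and spl: "splits (generate G {c [^] d})"
  shows "\<exists>k \<phi>. \<forall>x\<in>X. total x = k + (\<Sum>j<n div d. \<phi> (act x (c [^] (d * j))))"
proof (cases "X = {}")
  case False
  then obtain x0 where x0: "x0 \<in> X" by blast
  obtain \<beta> where \<beta>: "\<And>a b. \<lbrakk>a \<in> generate G {c [^] d}; b \<in> generate G {c [^] d}\<rbrakk> \<Longrightarrow>
      const_on X (\<lambda>x. F a b x - \<beta> b (act x a) + \<beta> (a \<otimes> b) x - \<beta> a x)"
    using spl by (auto simp: splits_def)
  have gen: "c [^] (d * j) \<in> generate G {c [^] d}" for j
  proof -
    have "(c [^] d) [^] int j \<in> generate G {c [^] d}" using c by (subst generate_pow) auto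
    then show ?thesis using c by (simp add: int_pow_int nat_pow_pow)
  qed
  define T where "T j x = bnd (d * j) x - \<beta> (c [^] (d * j)) x" for j x
  have step: "T (Suc j) x - T j x - T 1 (act x (c [^] (d * j)))
       = T (Suc j) y - T j y - T 1 (act y (c [^] (d * j)))" if xy: "x \<in> X" "y \<in> X" for j x y
  proof -
    have "c [^] (d * j) \<otimes> c [^] d = c [^] (d * Suc j)" "d * Suc j = d * j + d"
      using c by (simp_all add: nat_pow_mult add.commute)
    then show ?thesis
      using const_onD[OF cocycle_pow_eq_coboundary[of "d * j" d] xy] const_onD[OF \<beta>[OF gen[of j] gen[of 1]] xy]
      by (simp add: T_def add.commute[of d])
  qed
  have T: "T e x - T 0 x - (\<Sum>j<e. T 1 (act x (c [^] (d * j))))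
       = T e y - T 0 y - (\<Sum>j<e. T 1 (act y (c [^] (d * j))))" if xy: "x \<in> X" "y \<in> X" for e x y
  proof (induction e)
    case (Suc e)
    then show ?case using step[OF xy, of e] by simp
  qed simp
  define e where "e = n div d"
  have e: "d * e = n" using assms(1) by (simp add: e_def)
  have "T e x - T 0 x = - total x" for x
    using n by (simp add: T_def e bnd_period)
  then have "total x = (total x0 + (\<Sum>j<e. T 1 (act x0 (c [^] (d * j))))) + (\<Sum>j<e. - T 1 (act x (c [^] (d * j))))"
    if "x \<in> X" for x
    using T[OF that x0, of e] by (simp add: sum_negf)
  then show ?thesis unfolding e_def[symmetric] by (intro exI ballI)
qed simp

text \<open>Adding the partial norms of \<open>\<phi>\<close> to \<open>bnd\<close> keeps the
  coboundary identity and gives periodicity modulo constants, so that the sum descends from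
  exponents to group elements.\<close>

lemma splits_if_total_eq_norm:
  assumes ord: "n = ord c" and tot: "\<And>x. x \<in> X \<Longrightarrow> total x = k + (\<Sum>j<n. \<phi> (act x (c [^] j)))"
    and fin: "finite (carrier G)"
  shows "splits (generate G {c})"
proof -
  define b where "b i x = bnd i x + (\<Sum>j<i. \<phi> (act x (c [^] j)))" for i x
  have cb: "const_on X (\<lambda>x. F (c [^] i) (c [^] j) x - b j (act x (c [^] i)) + b (i + j) x - b i x)" for i j
  proof (rule const_onI)
    fix x y assume xy: "x \<in> X" "y \<in> X"
    have "(\<Sum>t<i + j. \<phi> (act z (c [^] t))) = (\<Sum>t<i. \<phi> (act z (c [^] t))) + (\<Sum>t<j. \<phi> (act (act z (c [^] i)) (c [^] t)))"
      if "z \<in> X" for z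
      using that by (simp add: sum_lessThan_add act_pow)
    from this[OF xy(1)] this[OF xy(2)]
    show "F (c [^] i) (c [^] j) x - b j (act x (c [^] i)) + b (i + j) x - b i x
        = F (c [^] i) (c [^] j) y - b j (act y (c [^] i)) + b (i + j) y - b i y"
      using const_onD[OF cocycle_pow_eq_coboundary[of i j] xy] by (simp add: b_def)
  qed
  have bn: "b n x = b 0 x - k" if "x \<in> X" for x
    using tot[OF that] by (simp add: b_def bnd_period)
  have per1: "b (i + n) x - b i x = b (i + n) y - b i y" if xy: "x \<in> X" "y \<in> X" for i x y
  proof -
    have "act x (c [^] i) \<in> X" "act y (c [^] i) \<in> X" using xy c by (auto simp: act_closed)
    then show ?thesis
      using const_onD[OF cb[of i n] xy] const_onD[OF cb[of i 0] xy] n by (simp add: bn)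
  qed
  have per: "b (i + n * q) x - b i x = b (i + n * q) y - b i y" if xy: "x \<in> X" "y \<in> X" for i q x y
  proof (induction q)
    case (Suc q)
    then show ?case using per1[OF xy, of "i + n * q"] by (simp add: add_ac)
  qed simp
  have per2: "b i x - b j x = b i y - b j y" if xy: "x \<in> X" "y \<in> X" and eq: "c [^] i = c [^] j" for i j x y
  proof -
    have "c [^] int i = c [^] int j" using eq by (simp add: int_pow_int)
    then have "int n dvd int i - int j" using int_pow_eq[OF c] by (simp add: ord dvd_diff_commute)
    then have "i mod n = j mod n" by (metis mod_eq_dvd_iff of_nat_eq_iff of_nat_mod)
    then show ?thesis
      using per[OF xy, of "i mod n" "i div n"] per[OF xy, of "j mod n" "j div n"]
      unfolding mod_mult_div_eq by simp
  qed
  \<comment> \<open>An exponent is chosen for each power. \<open>ix (u \<otimes> v)\<close> may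
    differ from \<open>ix u + ix v\<close>, but by \<open>per2\<close> this costs only a
    constant.\<close>
  define ix where "ix a = (SOME i. c [^] (i::nat) = a)" for a
  have ix: "c [^] ix (c [^] (i::nat)) = c [^] i" for i
    unfolding ix_def by (rule someI[of _ i]) simp
  have "const_on X (\<lambda>x. F u v x - b (ix v) (act x u) + b (ix (u \<otimes> v)) x - b (ix u) x)"
    if uv: "u \<in> generate G {c}" "v \<in> generate G {c}" for u v
  proof (rule const_onI)
    fix x y assume xy: "x \<in> X" "y \<in> X"
    obtain i' j' :: nat where "u = c [^] i'" "v = c [^] j'"
      using uv generate_pow_on_finite_carrier[OF fin c] by auto
    then have u: "c [^] ix u = u" "c [^] ix v = v" by (simp_all add: ix)
    have "c [^] (ix u + ix v) = u \<otimes> v" unfolding nat_pow_mult[OF c, symmetric] u ..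
    with ix[of "ix u + ix v"] have "c [^] ix (u \<otimes> v) = c [^] (ix u + ix v)" by (simp only:)
    from per2[OF xy this] show "F u v x - b (ix v) (act x u) + b (ix (u \<otimes> v)) x - b (ix u) x
        = F u v y - b (ix v) (act y u) + b (ix (u \<otimes> v)) y - b (ix u) y"
      using const_onD[OF cb[of "ix u" "ix v"] xy] by (simp add: u)
  qed
  then show ?thesis unfolding splits_def by (intro exI[of _ "\<lambda>a. b (ix a)"]) blast
qed

end
end

text \<open>The norm criterion is applied to \<open>total\<close> and the action of
  \<open>c\<close>: if \<open>c [^] d\<close> fixes a point, the cocycle splits over the subgroup it
  generates, so \<open>total\<close> is a norm from there modulo constants.\<close>

lemma splits_cyclic_if_splits_stabilizers:
  assumes fin: "finite (carrier G)" "finite X" and c: "c \<in> carrier G"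
    and stab: "\<And>x u. \<lbrakk>x \<in> X; u \<in> carrier G; act x u = x\<rbrakk> \<Longrightarrow> splits (generate G {u})"
  shows "splits (generate G {c})"
proof -
  define n where "n = ord c"
  have n: "n > 0" "c [^] n = \<one>" using ord_ge_1[OF fin(1) c] c by (auto simp: n_def)
  have "\<exists>k \<phi>. \<forall>x\<in>X. total c n x = k + (\<Sum>j<n. \<phi> (((\<lambda>x. act x c) ^^ j) x))"
  proof (rule invariant_function_is_norm[OF fin(2) n(1)])
    fix x d assume x: "x \<in> X" and d: "d dvd n" "((\<lambda>x. act x c) ^^ d) x = x"
    have "splits (generate G {c [^] d})" using d x c by (intro stab[of x]) (simp_all add: funpow_act)
    from total_eq_norm_if_splits[OF c n d(1) this]
    show "\<exists>k \<phi>. \<forall>y\<in>X. total c n y = k + (\<Sum>j<n div d. \<phi> (((\<lambda>x. act x c) ^^ (d * j)) y))"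
      by (simp add: funpow_act c)
  next
    fix x assume x: "x \<in> X"
    then show "act x c \<in> X" using c by (simp add: act_closed)
    show "((\<lambda>x. act x c) ^^ n) x = x" using x by (simp add: funpow_act c n(2) act_one)
    show "total c n (act x c) = total c n x" using x by (rule total_invariant[OF c n])
  qed
  then obtain k \<phi> where "\<And>x. x \<in> X \<Longrightarrow> total c n x = k + (\<Sum>j<n. \<phi> (act x (c [^] j)))"
    by (auto simp: funpow_act c)
  from splits_if_total_eq_norm[OF c n n_def this fin(1)] show ?thesis .
qed

end


section \<open>The module J as functions modulo constants\<close>

text \<open>Reduces classes to cocycles: by \<open>res2_coset\<close> the restricted class is the
  coset of the restricted cocycle, and this is trivial iff the cocycle lies in
  \<open>B2\<close>.\<close>

lemma (in G_module) coset_in_Sha2_iff: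
  assumes f: "f \<in> Z2 G M" and sub: "\<And>D. D \<in> \<D> \<Longrightarrow> subgroup D G"
  shows "B2 G M #>\<^bsub>C2 G M\<^esub> f \<in> Sha2 G \<D> M \<longleftrightarrow>
    (\<forall>D\<in>\<D>. restrict f (D \<times> D) \<in> B2 (G\<lparr>carrier := D\<rparr>) M)"
proof -
  have "B2 G M #>\<^bsub>C2 G M\<^esub> f \<in> carrier (H2 G M)"
    using f by (auto simp: H2_def FactGroup_def RCOSETS_def r_coset_def)
  moreover have "res2 G M D (B2 G M #>\<^bsub>C2 G M\<^esub> f) = \<one>\<^bsub>H2 (G\<lparr>carrier := D\<rparr>) M\<^esub> \<longleftrightarrow>
      restrict f (D \<times> D) \<in> B2 (G\<lparr>carrier := D\<rparr>) M" if "D \<in> \<D>" for D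
  proof -
    interpret D: G_module "G\<lparr>carrier := D\<rparr>" M by (rule G_module_subgroup[OF sub[OF that]])
    interpret CD: comm_group "C2 (G\<lparr>carrier := D\<rparr>) M" by (rule D.group_C2)
    note r = res2_coset[OF sub[OF that] f]
    have "restrict f (D \<times> D) \<in> carrier (C2 (G\<lparr>carrier := D\<rparr>) M)"
      using r(1) subgroup.mem_carrier[OF D.subgroup_Z2] by blast
    then show ?thesis
      using CD.coset_join1[of "B2 (G\<lparr>carrier := D\<rparr>) M"] CD.coset_join2[of _ "B2 (G\<lparr>carrier := D\<rparr>) M"]
        D.subgroup_B2 subgroup.subset[OF D.subgroup_B2]
      by (auto simp: r(2) H2_def FactGroup_def)
  qed
  ultimately show ?thesis
    by (auto simp: Sha2_def kernel_def fun_eq_iff)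
qed

lemma (in G_module) Sha2_subset_cosets:
  "X \<in> Sha2 G \<D> M \<Longrightarrow> \<exists>f\<in>Z2 G M. X = B2 G M #>\<^bsub>C2 G M\<^esub> f"
  by (auto simp: Sha2_def kernel_def H2_def FactGroup_def RCOSETS_def r_coset_def)

section \<open>The G-set of cosets and its integer functions\<close>

locale subgroup_family = group G for G :: "('g, 'x) monoid_scheme" (structure) +
  fixes \<H> :: "'g set multiset"
  assumes subgroup_fam: "H \<in># \<H> \<Longrightarrow> subgroup H G"
begin

abbreviation "S \<equiv> sum_Ind G \<H>"
abbreviation "J \<equiv> J_module G \<H>"
abbreviation "idx \<equiv> mset_index \<H>"

text \<open>\<open>pts\<close> is the disjoint union of the right coset spaces \<open>H\G\<close>, on which \<open>S\<close> is the module of integer functions.\<close>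

definition pts :: "(('g set \<times> nat) \<times> 'g set) set"
  where "pts = (SIGMA p:idx. rcosets (fst p))"

definition act :: "('g set \<times> nat) \<times> 'g set \<Rightarrow> 'g \<Rightarrow> ('g set \<times> nat) \<times> 'g set"
  where "act z g = (fst z, snd z #> g)"

text \<open>A left \<open>H\<close>-invariant function on \<open>G\<close> is one that factors
  through the right cosets of \<open>H\<close>; \<open>of_fun\<close> pulls back along this
  projection.\<close>

definition of_fun :: "(('g set \<times> nat) \<times> 'g set \<Rightarrow> int) \<Rightarrow> 'g set \<times> nat \<Rightarrow> 'g \<Rightarrow> int"
  where "of_fun u = (\<lambda>p\<in>idx. \<lambda>x\<in>carrier G. u (p, fst p #> x))"

definition cls :: "(('g set \<times> nat) \<times> 'g set \<Rightarrow> int) \<Rightarrow> ('g set \<times> nat \<Rightarrow> 'g \<Rightarrow> int) set"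
  where "cls u = range (const_Ind G \<H>) #>\<^bsub>S\<^esub> of_fun u"

lemma subgroup_index: "p \<in> idx \<Longrightarrow> subgroup (fst p) G"
  by (auto simp: mset_index_def subgroup_fam)

lemma ptsE:
  assumes "z \<in> pts"
  obtains p x where "p \<in> idx" "x \<in> carrier G" "z = (p, fst p #> x)"
  using assms by (auto simp: pts_def RCOSETS_def)

lemma ptsI: "\<lbrakk>p \<in> idx; x \<in> carrier G\<rbrakk> \<Longrightarrow> (p, fst p #> x) \<in> pts"
  by (auto simp: pts_def RCOSETS_def)

lemma act_coset: "\<lbrakk>p \<in> idx; x \<in> carrier G; g \<in> carrier G\<rbrakk> \<Longrightarrow>
    act (p, fst p #> x) g = (p, fst p #> (x \<otimes> g))"
  using subgroup.subset[OF subgroup_index] by (simp add: act_def coset_mult_assoc)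

lemma finite_pts: "finite (carrier G) \<Longrightarrow> finite pts"
proof -
  assume fin: "finite (carrier G)"
  have "finite (rcosets (fst p))" for p unfolding RCOSETS_def using fin by auto
  then show ?thesis unfolding pts_def by (intro finite_SigmaI) (auto simp: mset_index_def)
qed

lemma group_Ind: "p \<in> idx \<Longrightarrow> group (case p of (H, _) \<Rightarrow> Ind G H)"
  using G_module_Ind[OF subgroup_index, of p] by (simp add: G_module_def comm_group_def split_beta)

lemma carrier_S: "carrier S = (\<Pi>\<^sub>E p\<in>idx. carrier (Ind G (fst p)))"
proof -
  have "finite idx" by (simp add: mset_index_def)
  then show ?thesis
    by (simp add: sum_Ind_def sum_gmodule_def carrier_sum_group[OF group_Ind] split_beta)
qed

lemma mult_S: "m \<otimes>\<^bsub>S\<^esub> m' = (\<lambda>p\<in>idx. \<lambda>x\<in>carrier G. m p x + m' p x)"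
  by (auto simp: sum_Ind_def sum_gmodule_def Ind_def split_beta intro!: restrict_ext)

lemma gact_S: "gact S g m = (\<lambda>p\<in>idx. \<lambda>x\<in>carrier G. m p (x \<otimes> g))"
  by (auto simp: sum_Ind_def sum_gmodule_def Ind_def split_beta intro!: restrict_ext)

lemma G_module_S: "G_module G S"
  unfolding sum_Ind_def by (rule G_module_sum) (use G_module_Ind[OF subgroup_index] in \<open>auto simp: split_beta\<close>)

lemma coset_absorb: "\<lbrakk>p \<in> idx; h \<in> fst p; x \<in> carrier G\<rbrakk> \<Longrightarrow> fst p #> (h \<otimes> x) = fst p #> x"
  using subgroup_index[of p] by (simp add: coset_join2 coset_mult_assoc[symmetric] subgroup.subset subgroup.mem_carrier)

lemma of_fun_closed: "of_fun u \<in> carrier S"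
  by (auto simp: carrier_S of_fun_def Ind_def coset_absorb subgroup.mem_carrier[OF subgroup_index])

lemma of_fun_mult: "of_fun u \<otimes>\<^bsub>S\<^esub> of_fun v = of_fun (\<lambda>z. u z + v z)"
  by (auto simp: mult_S of_fun_def intro!: restrict_ext)

lemma gact_of_fun: "g \<in> carrier G \<Longrightarrow> gact S g (of_fun u) = of_fun (\<lambda>z. u (act z g))"
  unfolding gact_S of_fun_def by (intro restrict_ext) (simp add: act_coset)

lemma const_Ind_eq: "const_Ind G \<H> n = of_fun (\<lambda>_. n)"
  by (simp add: const_Ind_def of_fun_def)

lemma of_fun_eq_iff: "of_fun u = of_fun v \<longleftrightarrow> (\<forall>z\<in>pts. u z = v z)"
proof
  assume eq: "of_fun u = of_fun v"
  show "\<forall>z\<in>pts. u z = v z"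
  proof
    fix z assume "z \<in> pts"
    then obtain p x where z: "p \<in> idx" "x \<in> carrier G" "z = (p, fst p #> x)" by (rule ptsE)
    then show "u z = v z" using fun_cong[OF fun_cong[OF eq, of p], of x] by (simp add: of_fun_def)
  qed
next
  assume "\<forall>z\<in>pts. u z = v z"
  then show "of_fun u = of_fun v" unfolding of_fun_def by (intro restrict_ext) (simp add: ptsI)
qed

lemma of_fun_surj:
  assumes "m \<in> carrier S" obtains u where "m = of_fun u"
proof
  define u where "u z = m (fst z) (SOME y. y \<in> snd z)" for z
  have "m p x = u (p, fst p #> x)" if p: "p \<in> idx" and x: "x \<in> carrier G" for p x
  proof -
    have "x \<in> fst p #> x" using rcos_self[OF x subgroup_index[OF p]] .
    then have "(SOME y. y \<in> fst p #> x) \<in> fst p #> x" by (rule someI)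
    then obtain h where "h \<in> fst p" "(SOME y. y \<in> fst p #> x) = h \<otimes> x" by (auto simp: r_coset_def)
    moreover have "m p \<in> carrier (Ind G (fst p))" using assms p by (auto simp: carrier_S)
    ultimately show ?thesis using x by (simp add: u_def Ind_def)
  qed
  moreover have "m p \<in> extensional (carrier G)" if "p \<in> idx" for p
    using assms that by (auto simp: carrier_S Ind_def PiE_iff)
  moreover have "m \<in> extensional idx" using assms by (auto simp: carrier_S PiE_iff)
  ultimately show "m = of_fun u"
    by (auto simp: of_fun_def fun_eq_iff extensional_def)
qed

lemma const_Ind_hom: "const_Ind G \<H> \<in> hom integer_group S"
  by (auto simp: hom_def const_Ind_eq of_fun_closed of_fun_mult)

lemma subgroup_const: "subgroup (range (const_Ind G \<H>)) S"
proof -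
  interpret S: G_module G S by (rule G_module_S)
  have "group_hom integer_group S (const_Ind G \<H>)"
    using const_Ind_hom by (simp add: group_hom_def group_hom_axioms_def S.M.group_axioms)
  from group_hom.img_is_subgroup[OF this] show ?thesis by simp
qed

lemma G_module_J_family: "G_module G J"
  by (rule G_module_J) (rule subgroup_fam)

lemma cls_closed: "cls u \<in> carrier J"
  using of_fun_closed by (auto simp: J_module_def coker_gmodule_def cls_def FactGroup_def RCOSETS_def)

lemma cls_surj:
  assumes "X \<in> carrier J" obtains u where "X = cls u"
proof -
  from assms obtain m where "m \<in> carrier S" "X = range (const_Ind G \<H>) #>\<^bsub>S\<^esub> m"
    by (auto simp: J_module_def coker_gmodule_def FactGroup_def RCOSETS_def)
  then show thesis using that by (metis cls_def of_fun_surj)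
qed

lemma cls_mult: "cls u \<otimes>\<^bsub>J\<^esub> cls v = cls (\<lambda>z. u z + v z)"
proof -
  interpret S: G_module G S by (rule G_module_S)
  have "range (const_Ind G \<H>) \<lhd> S" by (rule S.M.subgroup_imp_normal[OF subgroup_const])
  from normal.rcos_sum[OF this of_fun_closed of_fun_closed] show ?thesis
    by (simp add: J_module_def coker_gmodule_def cls_def FactGroup_def of_fun_mult)
qed

lemma mem_cls: "m \<in> cls u \<longleftrightarrow> (\<exists>n. m = of_fun (\<lambda>z. n + u z))"
  by (auto simp: cls_def r_coset_def const_Ind_eq of_fun_mult)

lemma gact_cls: "g \<in> carrier G \<Longrightarrow> gact J g (cls u) = cls (\<lambda>z. u (act z g))"
  by (force simp: J_module_def coker_gmodule_def mem_cls gact_of_fun)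

lemma cls_eq_iff: "cls u = cls v \<longleftrightarrow> const_on pts (\<lambda>z. u z - v z)"
proof
  assume "cls u = cls v"
  moreover have "of_fun u \<in> cls u" by (auto simp: mem_cls intro: exI[of _ 0])
  ultimately obtain n where "\<forall>z\<in>pts. u z = n + v z" by (auto simp: mem_cls of_fun_eq_iff)
  then show "const_on pts (\<lambda>z. u z - v z)" by (intro const_onI) simp
next
  assume c: "const_on pts (\<lambda>z. u z - v z)"
  \<comment> \<open>The constant is read off at a point; if there is none, any \<open>n\<close> will
    do.\<close>
  obtain n where n: "\<forall>z\<in>pts. u z = n + v z"
  proof (cases "pts = {}")
    case False
    then obtain w where "w \<in> pts" by blast
    with c have "\<forall>z\<in>pts. u z = (u w - v w) + v z" by (auto dest: const_onD[of _ _ w])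
    then show thesis by (rule that)
  qed (use that in auto)
  have uv: "of_fun (\<lambda>z. k + u z) = of_fun (\<lambda>z. (k + n) + v z)" for k
    unfolding of_fun_eq_iff using n by auto
  have vu: "of_fun (\<lambda>z. k + v z) = of_fun (\<lambda>z. (k - n) + u z)" for k
    unfolding of_fun_eq_iff using n by auto
  show "cls u = cls v"
  proof (intro Set.set_eqI iffI)
    show "m \<in> cls v" if "m \<in> cls u" for m using that uv unfolding mem_cls by blast
    show "m \<in> cls u" if "m \<in> cls v" for m using that vu unfolding mem_cls by blast
  qed
qed

lemma one_J: "\<one>\<^bsub>J\<^esub> = cls (\<lambda>_. 0)"
proof -
  have "\<one>\<^bsub>J\<^esub> = range (const_Ind G \<H>)"
    by (simp add: J_module_def coker_gmodule_def FactGroup_def)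
  also have "\<dots> = cls (\<lambda>_. 0)" by (auto simp: mem_cls const_Ind_eq)
  finally show ?thesis .
qed

lemma inv_cls: "inv\<^bsub>J\<^esub> cls u = cls (\<lambda>z. - u z)"
proof -
  interpret J: G_module G J by (rule G_module_J_family)
  show ?thesis
    by (rule J.M.inv_equality) (simp_all add: cls_mult one_J cls_closed)
qed

lemmas cls_simps = cls_mult inv_cls gact_cls cls_eq_iff one_J

text \<open>Equality in \<open>J\<close> is equality of lifts up to a constant, so any choice of
  lifts of the values will do.\<close>

lemma cocycle_lift:
  assumes f: "f \<in> Z2 G J" and F: "\<And>g h. \<lbrakk>g \<in> carrier G; h \<in> carrier G\<rbrakk> \<Longrightarrow> f (g, h) = cls (F g h)"
  shows "cocycle_mod_const G pts act F"
proof unfold_locales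
  fix z g h
  show "act z g \<in> pts" if "z \<in> pts" "g \<in> carrier G"
    using that by (elim ptsE) (simp add: act_coset ptsI)
  show "act z \<one> = z" if "z \<in> pts"
    using that by (elim ptsE) (simp add: act_coset)
  show "act z (g \<otimes> h) = act (act z g) h" if "z \<in> pts" "g \<in> carrier G" "h \<in> carrier G"
    using that by (elim ptsE) (simp add: act_coset m_assoc)
next
  fix g h k assume g: "g \<in> carrier G" "h \<in> carrier G" "k \<in> carrier G"
  have "d2 G J f (g, h, k) = \<one>\<^bsub>C3 G J\<^esub> (g, h, k)"
    using f by (simp add: Z2_def kernel_def)
  then show "const_on pts (\<lambda>x. F h k (act x g) - F (g \<otimes> h) k x + F g (h \<otimes> k) x - F g h x)"
    using g by (simp add: d2_def C3_def F cls_simps)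
qed

text \<open>Cochains in \<open>J\<close> lift pointwise because \<open>cls\<close> is onto, and
  \<open>cls_eq_iff\<close> translates the coboundary equation.\<close>

lemma restrict_in_B2_iff_splits:
  assumes F: "\<And>g h. \<lbrakk>g \<in> carrier G; h \<in> carrier G\<rbrakk> \<Longrightarrow> f (g, h) = cls (F g h)"
    and coc: "cocycle_mod_const G pts act F" and D: "subgroup D G"
  shows "restrict f (D \<times> D) \<in> B2 (G\<lparr>carrier := D\<rparr>) J \<longleftrightarrow> cocycle_mod_const.splits G pts act F D"
proof -
  interpret cocycle_mod_const G pts act F by (rule coc)
  note [simp] = subgroup.mem_carrier[OF D] subgroup.m_closed[OF D]
  have *: "gact J a (cls (\<beta> b)) \<otimes>\<^bsub>J\<^esub> inv\<^bsub>J\<^esub> cls (\<beta> (a \<otimes> b)) \<otimes>\<^bsub>J\<^esub> cls (\<beta> a) = f (a, b) \<longleftrightarrow>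
      const_on pts (\<lambda>x. F a b x - \<beta> b (act x a) + \<beta> (a \<otimes> b) x - \<beta> a x)"
    if "a \<in> D" "b \<in> D" for \<beta> a b
  proof -
    have "gact J a (cls (\<beta> b)) \<otimes>\<^bsub>J\<^esub> inv\<^bsub>J\<^esub> cls (\<beta> (a \<otimes> b)) \<otimes>\<^bsub>J\<^esub> cls (\<beta> a) = f (a, b) \<longleftrightarrow>
      f (a, b) = gact J a (cls (\<beta> b)) \<otimes>\<^bsub>J\<^esub> inv\<^bsub>J\<^esub> cls (\<beta> (a \<otimes> b)) \<otimes>\<^bsub>J\<^esub> cls (\<beta> a)" by auto
    also have "\<dots> \<longleftrightarrow> const_on pts (\<lambda>x. F a b x - \<beta> b (act x a) + \<beta> (a \<otimes> b) x - \<beta> a x)"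
      using that by (simp add: F cls_simps algebra_simps)
    finally show ?thesis .
  qed
  show ?thesis
  proof
    assume "restrict f (D \<times> D) \<in> B2 (G\<lparr>carrier := D\<rparr>) J"
    then obtain c where c: "c \<in> D \<rightarrow>\<^sub>E carrier J" and eq: "restrict f (D \<times> D) = d1 (G\<lparr>carrier := D\<rparr>) J c"
      by (auto simp: B2_def C1_def)
    have "\<exists>u. c a = cls u" if "a \<in> D" for a using c that by (metis PiE_mem cls_surj)
    then obtain \<beta> where \<beta>: "\<And>a. a \<in> D \<Longrightarrow> c a = cls (\<beta> a)" by metis
    have "const_on pts (\<lambda>x. F a b x - \<beta> b (act x a) + \<beta> (a \<otimes> b) x - \<beta> a x)" if "a \<in> D" "b \<in> D" for a b
      using *[OF that, of \<beta>] fun_cong[OF eq, of "(a, b)"] that by (simp add: d1_def \<beta>)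
    then show "splits D" by (auto simp: splits_def)
  next
    assume "splits D"
    then obtain \<beta> where \<beta>: "\<And>a b. \<lbrakk>a \<in> D; b \<in> D\<rbrakk> \<Longrightarrow>
        const_on pts (\<lambda>x. F a b x - \<beta> b (act x a) + \<beta> (a \<otimes> b) x - \<beta> a x)"
      by (auto simp: splits_def)
    have "f (a, b) = gact J a (cls (\<beta> b)) \<otimes>\<^bsub>J\<^esub> inv\<^bsub>J\<^esub> cls (\<beta> (a \<otimes> b)) \<otimes>\<^bsub>J\<^esub> cls (\<beta> a)"
      if "a \<in> D" "b \<in> D" for a b
      using *[OF that, of \<beta>] \<beta>[OF that] by simp
    then have "restrict f (D \<times> D) = d1 (G\<lparr>carrier := D\<rparr>) J (\<lambda>a\<in>D. cls (\<beta> a))"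
      by (intro ext) (auto simp: d1_def restrict_def)
    moreover have "(\<lambda>a\<in>D. cls (\<beta> a)) \<in> carrier (C1 (G\<lparr>carrier := D\<rparr>) J)"
      by (auto simp: C1_def cls_closed)
    ultimately show "restrict f (D \<times> D) \<in> B2 (G\<lparr>carrier := D\<rparr>) J"
      by (auto simp: B2_def)
  qed
qed

text \<open>If \<open>u\<close> fixes the coset \<open>H #> x\<close>, then
  \<open>x \<otimes> u \<otimes> inv x\<close> lies in \<open>H\<close>. By \<open>stab\<close>,
  \<open>f\<close> is trivial on the subgroup it generates, and \<open>splits_conj\<close> carries
  this back to \<open>u\<close>.\<close>

lemma restrict_cyclic_in_B2:
  assumes fin: "finite (carrier G)" and f: "f \<in> Z2 G J" and c: "c \<in> carrier G"
    and stab: "\<And>H u. \<lbrakk>H \<in># \<H>; u \<in> H\<rbrakk> \<Longrightarrow>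
      restrict f (generate G {u} \<times> generate G {u}) \<in> B2 (G\<lparr>carrier := generate G {u}\<rparr>) J"
  shows "restrict f (generate G {c} \<times> generate G {c}) \<in> B2 (G\<lparr>carrier := generate G {c}\<rparr>) J"
proof -
  have "\<exists>u. f (g, h) = cls u" if "g \<in> carrier G" "h \<in> carrier G" for g h
  proof -
    have "f (g, h) \<in> carrier J"
      using f that by (auto simp: Z2_def kernel_def C2_def)
    then show ?thesis by (metis cls_surj)
  qed
  then obtain F where F: "\<And>g h. \<lbrakk>g \<in> carrier G; h \<in> carrier G\<rbrakk> \<Longrightarrow> f (g, h) = cls (F g h)" by metis
  note coc = cocycle_lift[OF f F]
  interpret cocycle_mod_const G pts act F by (rule coc)
  note B2_iff = restrict_in_B2_iff_splits[OF F coc generate_is_subgroup]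
  have "splits (generate G {u})" if z: "z \<in> pts" and u: "u \<in> carrier G" "act z u = z" for z u
  proof -
    obtain p x where p: "p \<in> idx" and x: "x \<in> carrier G" and zp: "z = (p, fst p #> x)"
      using z by (rule ptsE)
    have H: "fst p \<in># \<H>" using p by (auto simp: mset_index_def)
    let ?v = "x \<otimes> u \<otimes> inv x"
    have "fst p #> (x \<otimes> u) = fst p #> x" using u p x by (simp add: zp act_coset)
    then have "x \<otimes> u \<in> fst p #> x" using rcos_self[OF _ subgroup_index[OF p], of "x \<otimes> u"] x u by simp
    then obtain h where "h \<in> fst p" "x \<otimes> u = h \<otimes> x" by (auto simp: r_coset_def)
    then have v: "?v \<in> fst p"
      using x subgroup.mem_carrier[OF subgroup_index[OF p]] by (simp add: m_assoc)
    show ?thesis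
    proof (rule splits_conj[OF x])
      show "generate G {u} \<subseteq> carrier G" using u by (simp add: generate_incl)
      show "splits (generate G {?v})" using stab[OF H v] B2_iff[of "{?v}"] x u by simp
      have pw: "x \<otimes> u [^] i \<otimes> inv x = ?v [^] i" for i :: nat
      proof (induction i)
        case (Suc i)
        have "x \<otimes> u [^] Suc i \<otimes> inv x = (x \<otimes> u [^] i \<otimes> inv x) \<otimes> ?v"
          using x u by (simp add: m_assoc) (simp flip: m_assoc)
        then show ?case using Suc by simp
      qed (use x in simp)
      show "x \<otimes> a \<otimes> inv x \<in> generate G {?v}" if "a \<in> generate G {u}" for a
        using that pw generate_pow_on_finite_carrier[OF fin u(1)]
          generate_pow_on_finite_carrier[OF fin, of ?v] x u by auto
    qed
  qed
  from splits_cyclic_if_splits_stabilizers[OF fin finite_pts[OF fin] c this]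
  show ?thesis using B2_iff[of "{c}"] c by simp
qed

end

theorem theorem5p11:
  fixes G :: "('g, 'x) monoid_scheme" and \<H> :: "'g set multiset" and \<D> :: "'g set set"
  assumes "group G" and "finite (carrier G)"
    and "\<And>H. H \<in># \<H> \<Longrightarrow> subgroup H G"
    and "admissible G \<D>"
  shows "Sha2 G \<D> (J_module G \<H>) = Sha2 G (remove_cyclic G \<H> \<D>) (J_module G \<H>)"
proof -
  interpret subgroup_family G \<H>
    using assms(1,3) by (simp add: subgroup_family_def subgroup_family_axioms_def)
  interpret J: G_module G "J_module G \<H>" by (rule G_module_J_family)
  have sub: "subgroup D G" if "D \<in> \<D>" for D
    using assms(4) that by (auto simp: admissible_def)
  have rc: "remove_cyclic G \<H> \<D> \<subseteq> \<D>" by (auto simp: remove_cyclic_def)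
  have key: "restrict f (D \<times> D) \<in> B2 (G\<lparr>carrier := D\<rparr>) J"
    if f: "f \<in> Z2 G J" and D: "D \<in> \<D>"
      and rem: "\<forall>D\<in>remove_cyclic G \<H> \<D>. restrict f (D \<times> D) \<in> B2 (G\<lparr>carrier := D\<rparr>) J" for f D
  proof (cases "D \<in> remove_cyclic G \<H> \<D>")
    case False
    with D obtain c where c: "c \<in> carrier G" "D = generate G {c}"
      by (auto simp: remove_cyclic_def cyclic_subgroups_def)
    \<comment> \<open>Cyclic subgroups of members of \<open>\<H>\<close> belong to
      \<open>\<D>\<close> by admissibility and survive the removal because they lie in some
      \<open>H\<close>. They supply the triviality that \<open>restrict_cyclic_in_B2\<close> asks
      for.\<close>
    have "generate G {u} \<in> remove_cyclic G \<H> \<D>" if "H \<in># \<H>" "u \<in> H" for H u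
    proof -
      have H: "subgroup H G" using assms(3) that by blast
      then have "generate G {u} \<in> cyclic_subgroups G"
        using subgroup.mem_carrier[OF H that(2)] by (auto simp: cyclic_subgroups_def)
      moreover have "generate G {u} \<subseteq> H"
        using generate_subgroup_incl[OF _ H, of "{u}"] that by simp
      ultimately show ?thesis using assms(4) that by (auto simp: remove_cyclic_def admissible_def)
    qed
    then show ?thesis
      unfolding c(2) by (intro restrict_cyclic_in_B2[OF assms(2) f c(1)] bspec[OF rem])
  qed (use rem in blast)
  have "B2 G J #>\<^bsub>C2 G J\<^esub> f \<in> Sha2 G \<D> J \<longleftrightarrow>
      B2 G J #>\<^bsub>C2 G J\<^esub> f \<in> Sha2 G (remove_cyclic G \<H> \<D>) J" if f: "f \<in> Z2 G J" for f
  proof -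
    have iff: "B2 G J #>\<^bsub>C2 G J\<^esub> f \<in> Sha2 G \<D>' J \<longleftrightarrow>
        (\<forall>D\<in>\<D>'. restrict f (D \<times> D) \<in> B2 (G\<lparr>carrier := D\<rparr>) J)" if "\<D>' \<subseteq> \<D>" for \<D>'
      by (rule J.coset_in_Sha2_iff[OF f]) (use sub that in blast)
    show ?thesis
      unfolding iff[OF subset_refl] iff[OF rc] using key[OF f] rc by (meson subsetD)
  qed
  then show ?thesis
    by (intro equalityI subsetI) (metis J.Sha2_subset_cosets)+
qed

end
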